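(* There exist absolute constants $C_{\mathrm{SNR}} > 0$ and $C_d > 0$ with $C_d < C_{\mathrm{SNR}}$ such that the following holds. Let $\{X_1, X_2, \ldots\}$ be a sequence of independent real random variables with means $\mathbb{E}(X_i) = f_i$ and $\sup_{i \ge 1} \|X_i\|_{\psi_2} \le \sigma$. Let $\alpha \in (0,1)$ and let $\widehat{t}$ be the stopping time $$\widehat{t} = \inf\Big\{t \ge 2 : \ \exists\, j \in \{1, \ldots, \lfloor \log(t)/\log(2) \rfloor\} \text{ with } \widehat{D}_{t - 2^{j-1}, t} > b_t \Big\}, \qquad b_t = 2^{3/2}\sigma \log^{1/2}(t/\alpha), \quad t \ge 2,$$ where $\widehat{D}_{s,t}$ is the CUSUM statistic. (i) If $\Delta = \infty$ (all the means $f_i$ are equal), then $\mathbb{P}_\infty\{\widehat{t} < \infty\} < \alpha$. (ii) If there is a positive integer $\Delta \ge 1$ with $f_1 = \cdots = f_\Delta \ne f_{\Delta+1} = f_{\Delta+2} = \cdots$, then $\mathbb{P}_\Delta\{\widehat{t} \le \Delta\} < \alpha$, for any $\Delta \ge 1$. (iii) If the means are as in (ii), $\kappa = |f_\Delta - f_{\Delta+1}|$, and in addition $$\Delta \kappa^2 \sigma^{-2} \ge C_{\mathrm{SNR}} \log(\Delta/\alpha),$$ then, for all $\Delta \ge 1$, $$\mathbb{P}_\Delta\left\{\Delta < \widehat{t} \le \Delta + C_d \frac{\sigma^2 \log(\Delta/\alpha)}{\kappa^2}\right\} \ge 1 - \alpha.$$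
   Context: The Orlicz norm is $\|X\|_{\psi_2} = \inf\{t > 0 : \mathbb{E}\{\exp(X^2/t^2)\} \le 2\}$. For integers $1 \le s < t$ the CUSUM statistic is $$\widehat{D}_{s,t} = \left| \left(\frac{t-s}{ts}\right)^{1/2} \sum_{l=1}^s X_l - \left\{\frac{s}{t(t-s)}\right\}^{1/2} \sum_{l=s+1}^t X_l \right|.$$ The stopping time $\widehat{t}$ takes values in $\mathbb{N} \cup \{\infty\}$, with $\inf \emptyset = \infty$. $\mathbb{P}_\Delta$ denotes probability under any distribution of the sequence satisfying the stated assumptions with change point after time $\Delta$, and $\mathbb{P}_\infty$ denotes probability under any such distribution with constant means. "Absolute constant" means a number not depending on $\Delta, \kappa, \sigma, \alpha$ or the distributions of the data.
   Formalization: Part (iii) is proved for Δ ≥ 2: at Δ = 1 the condition and C_d < C_SNR make the delay window shorter than 1, so it contains no integer and the claim fails. Random variables live on a probability space whose outcomes are real sequences, which realises every law of the data. *)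

theory Defs
  imports "HOL-Probability.Probability"
begin

(* Absolute constants are chosen before the probability space, and HOL cannot quantify over types
   inside a formula; with a free type variable as the type of outcomes the constants could depend
   on it. The claims concern only the law of the sequence of observations, which is realised by
   real sequences as outcomes, so this type loses no generality. *)
type_synonym outcome = "nat \<Rightarrow> real"

(* The Orlicz norm is taken in ereal: it is \<infinity> when no t > 0 is admissible, whereas the
   infimum of the empty set in real is an unspecified number. For the same reason the expectation
   is a nonnegative integral, which is \<infinity> (and not 0) when exp (X^2/t^2) is not integrable. *)
definition psi2_norm :: "'a measure \<Rightarrow> ('a \<Rightarrow> real) \<Rightarrow> ereal" where
  "psi2_norm M X =
     Inf {ereal t | t. t > 0 \<and> (\<integral>\<^sup>+ \<omega>. ennreal (exp ((X \<omega>)\<^sup>2 / t\<^sup>2)) \<partial>M) \<le> 2}"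

definition cusum :: "(nat \<Rightarrow> real) \<Rightarrow> nat \<Rightarrow> nat \<Rightarrow> real" where
  "cusum x s t =
     \<bar>sqrt ((real t - real s) / (real t * real s)) * (\<Sum>l=1..s. x l)
      - sqrt (real s / (real t * (real t - real s))) * (\<Sum>l=s+1..t. x l)\<bar>"

definition threshold :: "real \<Rightarrow> real \<Rightarrow> nat \<Rightarrow> real" where
  "threshold \<sigma> \<alpha> t = 2 powr (3/2) * \<sigma> * sqrt (ln (real t / \<alpha>))"

(* The subtraction on nat does not truncate: j \<le> log 2 t gives 2^(j-1) \<le> t/2.
   In enat, Inf {} = \<infinity>.
   Integrality matters for the detection delay: if the change occurs at \<Delta> = 1, the signal-to-noise
   condition and C_d < C_SNR make the window (1, 1 + C_d * \<sigma>^2 * ln (1/\<alpha>) / \<kappa>^2] shorter than 1,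
   hence free of integers, so the delay bound can only be claimed for \<Delta> \<ge> 2. *)
definition detection_time :: "real \<Rightarrow> real \<Rightarrow> (nat \<Rightarrow> real) \<Rightarrow> enat" where
  "detection_time \<sigma> \<alpha> x =
     Inf (enat ` {t. t \<ge> 2 \<and>
       (\<exists>j\<in>{1..nat \<lfloor>ln (real t) / ln 2\<rfloor>}. cusum x (t - 2 ^ (j - 1)) t > threshold \<sigma> \<alpha> t)})"

end

(* A variable with psi_2 norm at most sigma satisfies
   E exp (l (X - E X)) <= exp (2/3 l^2 sigma^2). The constant 2/3 matters: CUSUM weights have
   Euclidean norm 1, so without a change Chernoff's bound at b_t gives a tail 2 (alpha/t)^3 for
   each window. At most t/2 windows are inspected at time t, so an alarm at t has probability at
   most alpha^3/t^2, and sum_{2 <= t <= n} 1/t^2 <= 1 - 1/n. This bounds false alarms by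
   alpha^3 (1 - 1/Delta) before Delta, leaving alpha/Delta of the budget for a missed detection.
   After the change, take a power of two w between h/2 and h, with h the allowed delay. The
   window of length w at time Delta + w splits the data exactly at Delta, its signal
   kappa sqrt (Delta w / (Delta + w)) is at least twice 4 sigma sqrt (log (Delta/alpha)), and
   this quantity dominates the threshold. A miss thus needs noise of that size, which has
   probability at most 2 (alpha/Delta)^6 <= alpha/Delta. *)
theory Submission
  imports Defs
begin

section \<open>Exponential inequalities\<close>

text \<open>The Lagrange remainder of order four has an even power of \<open>x\<close>, so no sign
  condition on \<open>x\<close> arises.\<close>

lemma exp_ge_cubic: "1 + x + x^2/2 + x^3/6 \<le> exp (x::real)"
proof -
  obtain t where "exp x = (\<Sum>m<4. x^m / fact m) + exp t / fact 4 * x^4"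
    using Maclaurin_exp_le by blast
  moreover have "exp t / fact 4 * x^4 \<ge> 0" by simp
  ultimately show ?thesis by (simp add: eval_nat_numeral)
qed

lemma exp_ge_quadratic: "x \<ge> 0 \<Longrightarrow> 1 + x + x^2/2 \<le> exp (x::real)"
  using exp_ge_cubic[of x] zero_le_power[of x 3] by linarith

text \<open>The constant 2/3 is tied to the breakpoint 3/2: from there on
  \<open>x \<le> 2/3 * x^2\<close>, so the second exponential wins alone. Before it, Taylor
  polynomials of the two exponentials are compared.\<close>

lemma exp_le_plus_exp_square: "exp x \<le> x + exp (2/3 * x^2)" for x :: real
proof -
  have q: "1 + 2/3*x^2 + 2/9*x^4 \<le> exp (2/3*x^2)"
    using exp_ge_quadratic[of "2/3*x^2"] by (simp add: power_mult_distrib power2_eq_square power4_eq_xxxx algebra_simps)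
  consider "x \<le> 0" | "0 \<le> x" "x \<le> 3/2" | "x \<ge> 3/2" by linarith
  then show ?thesis
  proof cases
    case 1
    obtain t where "exp x = (\<Sum>m<3. x^m / fact m) + exp t / fact 3 * x^3"
      using Maclaurin_exp_le by blast
    moreover have "exp t / fact 3 * x^3 \<le> 0" using 1 by (intro mult_nonneg_nonpos) (auto simp: power_le_zero_eq)
    ultimately have "exp x \<le> 1 + x + x^2/2" by (simp add: eval_nat_numeral)
    moreover have "x^4 \<ge> 0" "x^2\<ge>0" by simp_all
    ultimately show ?thesis using q by linarith
  next
    case 2
    obtain t where t: "\<bar>t\<bar> \<le> \<bar>x\<bar>" "exp x = (\<Sum>m<5. x^m / fact m) + exp t / fact 5 * x^5"
      using Maclaurin_exp_le by blast
    have "exp t \<le> exp (2*1)" using t 2 by simp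
    also have "\<dots> = exp 1 ^ 2" by (simp only: exp_double)
    also have "\<dots> \<le> 3^2" using exp_le by (intro power_mono) auto
    finally have "exp t / fact 5 * x^5 \<le> 9 / fact 5 * x^5" using 2 by (intro mult_right_mono) (auto simp: divide_simps)
    then have "exp x \<le> 1 + x + x^2/2 + x^3/6 + x^4/24 + 9/120*x^5" using t(2) by (simp add: eval_nat_numeral)
    moreover have "x^5 \<le> 3/2*x^4" using 2 mult_right_mono[of x "3/2" "x^4"] by (simp add: eval_nat_numeral)
    \<comment> \<open>This is the gap between the two polynomials once \<open>x^5\<close> is
      replaced by \<open>3/2*x^4\<close>: 1/6 = 2/3 - 1/2 and 49/720 = 2/9 - 1/24 - 3/2 * 9/120. The
      quadratic factor has negative discriminant and its minimum at 60/49.\<close>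
    moreover have "x^2*(1/6 - x/6 + 49/720*x^2) \<ge> 0"
    proof -
      have "1/6 - x/6 + 49/720*x^2 = 49/720*(x - 60/49)^2 + (1/6 - 49/720*(60/49)^2)" by (simp add: power2_eq_square algebra_simps)
      moreover have "\<dots> \<ge> 0" by (simp add: power2_eq_square)
      ultimately show ?thesis by simp
    qed
    then have "x^2/6 - x^3/6 + 49/720*x^4 \<ge> 0" by (simp add: power2_eq_square power3_eq_cube power4_eq_xxxx algebra_simps)
    ultimately show ?thesis using q by (simp add: )
  next
    case 3
    then have "x \<le> 2/3*x^2" by (simp add: power2_eq_square)
    then have "exp x \<le> exp (2/3*x^2)" by simp
    then show ?thesis using 3 by linarith
  qed
qed

text \<open>
  Of the pointwise bounds of \<open>exp (2 * x)\<close> by a linear function plus a multiple of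
  \<open>exp (x\<^sup>2)\<close>, this one gives after integration \<open>7/2 * (1 + \<mu>)\<close>, which is at most
  \<open>7/4 * exp (1 + 2 * \<mu>)\<close>; the factor \<open>exp (2 * \<mu>)\<close> is what centring removes.
\<close>

lemma exp_double_le: "exp (2*x) \<le> 7/4 * (2*x + exp (x^2))" for x :: real
proof -
  consider "x \<le> 0" | "0 \<le> x" "x \<le> 2" | "x \<ge> 2" by linarith
  then show ?thesis
  proof cases
    case 1
    define y where "y = -x"
    have y: "y \<ge> 0" using 1 y_def by simp
    have e1: "1 + y^2 + y^4/2 \<le> exp (y^2)" using exp_ge_quadratic[of "y^2"] by (simp add: power_mult_distrib power2_eq_square power4_eq_xxxx algebra_simps)
    have e2: "1 + 2*y + 2*y^2 \<le> exp (2*y)" using exp_ge_quadratic[of "2*y"] y by (simp add: power_mult_distrib)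
    have "1 \<le> 7/4*((1-y)^2 + y^4/2) * (1 + 2*y + 2*y^2)"
    proof -
      \<comment> \<open>A certificate by weighted squares with rounded coefficients. The product in
        the goal, minus 4/7, is \<open>y^6 + y^5 + 5/2*y^4 - 2*y^3 - y^2 + 3/7\<close>, which
        dominates the certificate coefficient by coefficient.\<close>
      have "0 \<le> y^4*(y-3/5)^2 + 11/5*(y^3*(y-3/5)^2) + 239/50*(y^2-117/400*y-9/50)^2 + 311/1000*(y-81/100)^2"
        using y by simp
      also have "\<dots> = y^6 + y^5 + 5/2*y^4 + (-20043/10000)*y^3 - 8006729/8000000*y^2 - 243/500000*y + 3589191/10000000"
        by (simp add: eval_nat_numeral field_simps)
      also have "\<dots> \<le> y^6 + y^5 + 5/2*y^4 - 2*y^3 - y^2 + 3/7"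
        using y zero_le_power[OF y, of 3] zero_le_power2[of y] by linarith
      finally show ?thesis by (simp add: eval_nat_numeral field_simps)
    qed
    also have "\<dots> \<le> 7/4*((1-y)^2 + y^4/2) * exp (2*y)" using e2 by (intro mult_left_mono) auto
    also have "\<dots> \<le> 7/4*(exp (y^2) - 2*y) * exp (2*y)" using e1 by (intro mult_right_mono) (auto simp: power2_eq_square algebra_simps)
    finally have "exp (-2*y) \<le> 7/4*(exp (y^2) - 2*y) * exp (2*y) * exp(-2*y)" by simp
    then show ?thesis by (simp add: y_def mult.assoc flip: exp_add)
  next
    case 2
    \<comment> \<open>Around \<open>x = 1\<close> the two exponentials share the factor
      \<open>exp (2*u)\<close>: they are \<open>e^2 * exp (2*u)\<close> and
      \<open>e * exp (2*u) * exp (u^2)\<close>. Dividing it out and using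
      \<open>1 + u^2 \<le> exp (u^2)\<close> leaves an inequality in \<open>u\<close>, the number
      \<open>e\<close> and \<open>exp (-2*u)\<close>.\<close>
    define u where "u = x - 1"
    define e where "e = exp (1::real)"
    have u: "-1 \<le> u" "u \<le> 1" using 2 u_def by auto
    have e: "2.71 \<le> e" "e \<le> 2.72" using e_approx_32 e_less_272 unfolding e_def by (auto simp: abs_if split: if_splits)
    have c: "1 - 2*u + 2*u^2 - 4/3*u^3 \<le> exp (-2*u)" using exp_ge_cubic[of "-2*u"] by (simp add: power_mult_distrib)
    have "e^2 - 7/4*e*(1+u^2) \<le> 7/2*(1+u)*exp(-2*u)"
    proof (cases "u \<ge> 3/4")
      \<comment> \<open>The cubic bound for \<open>exp (-2*u)\<close> is negative at
        \<open>u = 1\<close>, but here the left side is already nonpositive, as 7/4 * (1 + 9/16)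
        exceeds 2.72.\<close>
      case True
      have "u^2 \<ge> (3/4)^2" using True by (intro power_mono) auto
      then have "e \<le> 7/4*(1+u^2)" using e by (simp add: power2_eq_square)
      then have "e*e \<le> e*(7/4*(1+u^2))" using e by (intro mult_left_mono) auto
      then have "e^2 - 7/4*e*(1+u^2) \<le> 0" by (simp add: power2_eq_square algebra_simps)
      moreover have "0 \<le> 7/2*(1+u)*exp(-2*u)" using u by simp
      ultimately show ?thesis by linarith
    next
      case False
      have "e^2 - 7/4*e*(1+u^2) = e*(e-7/4) - 7/4*e*u^2" by (simp add: power2_eq_square algebra_simps)
      also have "\<dots> \<le> 2.72*(2.72-7/4) - 7/4*2.71*u^2"
        using e by (intro diff_mono mult_mono mult_right_mono) auto
      also have "\<dots> \<le> 7/2*((1+u)*(1 - 2*u + 2*u^2 - 4/3*u^3))"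
      proof -
        \<comment> \<open>Right side minus left side, where 1897/400 = 7/4 * 2.71 and 861/1000
          rounds 7/2 - 2.72 * (2.72 - 7/4) down.\<close>
        have "861/1000 - 7/2*u + 1897/400*u^2 + 7/3*(u^3*(1-2*u)) \<ge> 0"
        proof (cases "u \<le> 0")
          case True
          have "u^2*(1+u) \<ge> 0" "u^2*(1+u)*(1-u) \<ge> 0" "u*(1+u) \<le> 0" using True u by (auto intro: mult_nonpos_nonneg)
          then show ?thesis using True by (simp add: power2_eq_square power3_eq_cube algebra_simps)
        next
          case F: False
          have "u^2*(3/8 + u*(1-2*u)) \<ge> 0"
          proof -
            have "(u+1/4)*(3/4-u) \<ge> 0" using F False by (intro mult_nonneg_nonneg) auto
            then have "3/8 + u*(1-2*u) \<ge> 0" by (simp add: algebra_simps)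
            then show ?thesis by simp
          qed
          moreover have "(u - 9/20)^2 \<ge> 0" by simp
          ultimately show ?thesis using False by (simp add: power2_eq_square power3_eq_cube algebra_simps)
        qed
        moreover have "7/2*((1+u)*(1 - 2*u + 2*u^2 - 4/3*u^3)) = 7/2 - 7/2*u + 7/3*(u^3*(1-2*u))"
          by (simp add: power2_eq_square power3_eq_cube field_simps)
        ultimately show ?thesis by simp
      qed
      also have "\<dots> \<le> 7/2*((1+u)*exp(-2*u))" using c u by (intro mult_left_mono) auto
      finally show ?thesis by (simp only: mult.assoc)
    qed
    then have "(e^2 - 7/4*e*(1+u^2)) * exp (2*u) \<le> 7/2*(1+u)*exp(-2*u) * exp(2*u)" by (intro mult_right_mono) auto
    also have "\<dots> = 7/2*x" by (simp add: u_def mult.assoc flip: exp_add)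
    finally have "e^2*exp(2*u) \<le> 7/2*x + 7/4*(e*exp(2*u)*(1+u^2))" by (simp add: field_simps)
    also have "\<dots> \<le> 7/2*x + 7/4*(e*exp(2*u)*exp(u^2))" using exp_ge_add_one_self[of "u^2"] e by (intro add_mono mult_left_mono) auto
    also have "e*exp(2*u)*exp(u^2) = exp(x^2)" by (simp add: u_def e_def power2_eq_square algebra_simps flip: exp_add)
    also have "e^2*exp(2*u) = exp (2*x)" by (simp add: u_def e_def power2_eq_square algebra_simps flip: exp_add)
    finally show ?thesis by simp
  next
    case 3
    then have "exp (2*x) \<le> exp (x^2)" by (simp add: power2_eq_square)
    moreover have "0 \<le> 7/2*x + 3/4*exp (x^2)" using 3 by simp
    moreover have "7/4 * (2*x + exp (x^2)) = exp (x^2) + (7/2*x + 3/4*exp (x^2))" by (simp add: field_simps)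
    ultimately show ?thesis by linarith
  qed
qed

section \<open>Exponential moments and tails under a bound on the Orlicz norm\<close>

text \<open>This is the case of scale 1; other scales are reached through
  \<open>X / \<sigma>\<close>. From \<open>1 + x^2 \<le> exp (x^2)\<close> the second moment is at
  most 1, and since the variance is nonnegative the mean is at most 1 in absolute value. Linear
  exponents are dominated by completing the square.\<close>

lemma (in prob_space) psi2_bounded_moments:
  fixes X :: "'a \<Rightarrow> real"
  assumes X: "random_variable borel X"
    and psi: "(\<integral>\<^sup>+ \<omega>. ennreal (exp ((X \<omega>)\<^sup>2)) \<partial>M) \<le> 2"
  shows "integrable M (\<lambda>\<omega>. exp ((X \<omega>)\<^sup>2))" "expectation (\<lambda>\<omega>. exp ((X \<omega>)\<^sup>2)) \<le> 2"
    and "integrable M X" "integrable M (\<lambda>\<omega>. (X \<omega>)\<^sup>2)" "expectation (\<lambda>\<omega>. (X \<omega>)\<^sup>2) \<le> 1"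
    and "\<bar>expectation X\<bar> \<le> 1"
    and "integrable M (\<lambda>\<omega>. exp (l * X \<omega>))"
proof -
  note [measurable] = X
  have 1: "integrable M (\<lambda>\<omega>. exp ((X \<omega>)\<^sup>2))"
    using psi by (intro integrableI_nonneg) (auto simp: le_less_trans)
  then show "integrable M (\<lambda>\<omega>. exp ((X \<omega>)\<^sup>2))" .
  have "ennreal (expectation (\<lambda>\<omega>. exp ((X \<omega>)\<^sup>2))) \<le> ennreal 2"
    using psi by (subst nn_integral_eq_integral[symmetric]) (auto simp: 1)
  then show 2: "expectation (\<lambda>\<omega>. exp ((X \<omega>)\<^sup>2)) \<le> 2"
    by (subst (asm) ennreal_le_iff) auto
  have b: "1 + x^2 \<le> exp (x^2)" for x :: real by simp
  show 3: "integrable M (\<lambda>\<omega>. (X \<omega>)\<^sup>2)"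
  proof (intro Bochner_Integration.integrable_bound[OF 1] AE_I2)
    show "norm ((X \<omega>)\<^sup>2) \<le> norm (exp ((X \<omega>)\<^sup>2))" for \<omega> using b[of "X \<omega>"] by (simp del: exp_ge_add_one_self)
  qed simp
  show 4: "integrable M X"
  proof (intro Bochner_Integration.integrable_bound[OF 1] AE_I2)
    fix \<omega>
    have "2*\<bar>X \<omega>\<bar> \<le> 1 + (X \<omega>)^2" using zero_le_power2[of "\<bar>X \<omega>\<bar> - 1"] by (simp add: power2_eq_square algebra_simps)
    then show "norm (X \<omega>) \<le> norm (exp ((X \<omega>)\<^sup>2))" using b[of "X \<omega>"] by (simp del: exp_ge_add_one_self)
  qed simp
  have "expectation (\<lambda>\<omega>. 1 + (X \<omega>)\<^sup>2) \<le> expectation (\<lambda>\<omega>. exp ((X \<omega>)\<^sup>2))"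
    using 1 3 b by (intro integral_mono) auto
  then show 5: "expectation (\<lambda>\<omega>. (X \<omega>)\<^sup>2) \<le> 1" using 2 3 by (simp add: prob_space)
  have "0 \<le> expectation (\<lambda>\<omega>. (X \<omega> - expectation X)^2)" by simp
  also have "\<dots> = expectation (\<lambda>\<omega>. (X \<omega>)\<^sup>2) - (expectation X)^2"
    using variance_eq[OF 4 3] by simp
  finally have "(expectation X)^2 \<le> 1" using 5 by linarith
  then show "\<bar>expectation X\<bar> \<le> 1" by (simp only: abs_square_le_1)
  show "integrable M (\<lambda>\<omega>. exp (l * X \<omega>))"
  proof (rule Bochner_Integration.integrable_bound[where f="\<lambda>\<omega>. exp (l^2/4) * exp ((X \<omega>)\<^sup>2)"], goal_cases)
    case 3
    show ?case
    proof (rule AE_I2)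
      fix \<omega>
      have "l * X \<omega> \<le> l^2/4 + (X \<omega>)^2" using zero_le_power2[of "l/2 - X \<omega>"] by (simp add: power2_eq_square algebra_simps)
      then show "norm (exp (l * X \<omega>)) \<le> norm (exp (l^2/4) * exp ((X \<omega>)\<^sup>2))" by (simp flip: exp_add)
    qed
  qed (use 1 in auto)
qed

text \<open>Log-convexity of the moment generating function, stated for upper bounds. Once the two
  exponentials are divided by \<open>exp A\<close> and \<open>exp B\<close>, it follows by
  integrating the pointwise convexity of \<open>exp\<close>.\<close>

lemma (in prob_space) expectation_exp_convex:
  fixes Y :: "'a \<Rightarrow> real"
  assumes "integrable M (\<lambda>\<omega>. exp (a * Y \<omega>))" "integrable M (\<lambda>\<omega>. exp (b * Y \<omega>))"
    and "integrable M (\<lambda>\<omega>. exp (((1 - s) * a + s * b) * Y \<omega>))"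
    and A: "expectation (\<lambda>\<omega>. exp (a * Y \<omega>)) \<le> exp A" and B: "expectation (\<lambda>\<omega>. exp (b * Y \<omega>)) \<le> exp B"
    and s: "0 \<le> s" "s \<le> 1"
  shows "expectation (\<lambda>\<omega>. exp (((1 - s) * a + s * b) * Y \<omega>)) \<le> exp ((1 - s) * A + s * B)"
proof -
  let ?A = "\<lambda>\<omega>. exp (a * Y \<omega>) * exp (-A)" and ?B = "\<lambda>\<omega>. exp (b * Y \<omega>) * exp (-B)"
  have "exp (((1 - s) * a + s * b) * Y \<omega>) * exp (-((1 - s) * A + s * B)) \<le> (1 - s) * ?A \<omega> + s * ?B \<omega>" for \<omega>
  proof -
    have "exp ((1 - s) *\<^sub>R (a * Y \<omega> - A) + s *\<^sub>R (b * Y \<omega> - B))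
        \<le> (1 - s) * exp (a * Y \<omega> - A) + s * exp (b * Y \<omega> - B)"
      by (rule convex_onD[OF convex_on_exp[of 1, simplified]]) (use s in auto)
    then show ?thesis by (simp add: algebra_simps flip: exp_add)
  qed
  then have "expectation (\<lambda>\<omega>. exp (((1 - s) * a + s * b) * Y \<omega>) * exp (-((1 - s) * A + s * B)))
      \<le> expectation (\<lambda>\<omega>. (1 - s) * ?A \<omega> + s * ?B \<omega>)"
    using assms by (intro integral_mono) auto
  also have "\<dots> = (1 - s) * (expectation (\<lambda>\<omega>. exp (a * Y \<omega>)) * exp (-A)) + s * (expectation (\<lambda>\<omega>. exp (b * Y \<omega>)) * exp (-B))"
    using assms by simp
  also have "\<dots> \<le> (1 - s) * (exp A * exp (-A)) + s * (exp B * exp (-B))"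
    using s A B by (intro add_mono mult_left_mono mult_right_mono) auto
  also have "\<dots> = 1" by (simp flip: exp_add)
  finally have "expectation (\<lambda>\<omega>. exp (((1 - s) * a + s * b) * Y \<omega>)) * exp (-((1 - s) * A + s * B)) \<le> 1"
    using assms(3) by simp
  then show ?thesis by (simp only: exp_minus) (simp add: field_simps)
qed

text \<open>
  For \<open>l\<^sup>2 \<le> 3/2\<close> the bound comes from \<open>exp_le_plus_exp_square\<close>, for \<open>l \<ge> 3\<close> from completing
  the square in \<open>l * X \<le> X\<^sup>2 + l\<^sup>2/4\<close>. In between, neither suffices: there the logarithm of the
  moment generating function is interpolated, by convexity, between \<open>0\<close>, \<open>2\<close> and \<open>3\<close>.
\<close>

lemma (in prob_space) psi2_bounded_mgf_nonneg:
  fixes X :: "'a \<Rightarrow> real"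
  assumes X: "random_variable borel X"
    and psi: "(\<integral>\<^sup>+ \<omega>. ennreal (exp ((X \<omega>)\<^sup>2)) \<partial>M) \<le> 2"
    and l: "l \<ge> 0"
  shows "expectation (\<lambda>\<omega>. exp (l * (X \<omega> - expectation X))) \<le> exp (2/3 * l\<^sup>2)"
proof -
  note [measurable] = X
  note mom = psi2_bounded_moments[OF X psi]
  define \<mu> where "\<mu> = expectation X"
  have \<mu>: "\<bar>\<mu>\<bar> \<le> 1" using mom(6) \<mu>_def by simp
  define K where "K l = expectation (\<lambda>\<omega>. exp (l * (X \<omega> - \<mu>)))" for l
  have int: "integrable M (\<lambda>\<omega>. exp (l * (X \<omega> - \<mu>)))" for l
    using mom(7)[of l] by (simp add: right_diff_distrib exp_diff)
  have K: "K l = expectation (\<lambda>\<omega>. exp (l * X \<omega>)) * exp (- (l * \<mu>))" for l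
    using mom(7)[of l] by (simp add: K_def right_diff_distrib exp_diff exp_minus field_simps)
  have small: "K l \<le> exp (2/3 * l^2)" if "l^2 \<le> 3/2" for l
  proof -
    define \<theta> where "\<theta> = 2/3 * l^2"
    have \<theta>: "0 \<le> \<theta>" "\<theta> \<le> 1" using that by (auto simp: \<theta>_def)
    have "exp (l * X \<omega>) \<le> l * X \<omega> + ((1 - \<theta>) + \<theta> * exp ((X \<omega>)^2))" for \<omega>
    proof -
      have "exp (l * X \<omega>) \<le> l * X \<omega> + exp (\<theta> * (X \<omega>)^2)"
        using exp_le_plus_exp_square[of "l * X \<omega>"] by (simp add: \<theta>_def power_mult_distrib mult.assoc)
      also have "exp ((1-\<theta>) *\<^sub>R 0 + \<theta> *\<^sub>R (X \<omega>)^2) \<le> (1 - \<theta>) * exp 0 + \<theta> * exp ((X \<omega>)^2)"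
        by (rule convex_onD[OF convex_on_exp[of 1, simplified]]) (use \<theta> in auto)
      then have "exp (\<theta> * (X \<omega>)^2) \<le> (1 - \<theta>) + \<theta> * exp ((X \<omega>)^2)" by simp
      finally show ?thesis by simp
    qed
    then have "expectation (\<lambda>\<omega>. exp (l * X \<omega>)) \<le> expectation (\<lambda>\<omega>. l * X \<omega> + ((1 - \<theta>) + \<theta> * exp ((X \<omega>)^2)))"
      using mom by (intro integral_mono) auto
    also have "\<dots> = l * \<mu> + ((1 - \<theta>) + \<theta> * expectation (\<lambda>\<omega>. exp ((X \<omega>)^2)))"
      using mom by (simp add: \<mu>_def prob_space)
    also have "\<dots> \<le> l * \<mu> + ((1 - \<theta>) + \<theta> * 2)" using mom(2) \<theta> by (intro add_left_mono mult_left_mono) auto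
    also have "\<dots> \<le> exp (\<theta> + l * \<mu>)" using exp_ge_add_one_self[of "\<theta> + l * \<mu>"] by (simp add: add_ac)
    finally have "K l \<le> exp (\<theta> + l * \<mu>) * exp (- (l * \<mu>))" unfolding K by (intro mult_right_mono) auto
    then show ?thesis by (simp add: \<theta>_def flip: exp_add)
  qed
  \<comment> \<open>8/5 = 1 + 3/5, with 3/5 an upper bound for ln (7/4). It stays well below 8/3,
    the value of \<open>2/3 * l\<^sup>2\<close> at 2, and this slack pays for the interpolation on
    both sides of 2.\<close>
  have two: "K 2 \<le> exp (8/5)"
  proof -
    have "expectation (\<lambda>\<omega>. exp (2 * X \<omega>)) \<le> expectation (\<lambda>\<omega>. 7/4 * (2 * X \<omega> + exp ((X \<omega>)^2)))"
      using mom exp_double_le by (intro integral_mono) auto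
    also have "\<dots> = 7/4 * (2 * \<mu> + expectation (\<lambda>\<omega>. exp ((X \<omega>)^2)))" using mom by (simp add: \<mu>_def)
    also have "\<dots> \<le> 7/4 * (1 + (1 + 2 * \<mu>))" using mom(2) by simp
    also have "\<dots> \<le> 7/4 * exp (1 + 2 * \<mu>)" by (intro mult_left_mono exp_ge_add_one_self) auto
    also have "\<dots> \<le> exp (3/5) * exp (1 + 2 * \<mu>)"
      using exp_lower_Taylor_quadratic[of "3/5"] by (intro mult_right_mono) (auto simp: power2_eq_square)
    finally have "K 2 \<le> exp (3/5) * exp (1 + 2 * \<mu>) * exp (- (2 * \<mu>))" unfolding K by (intro mult_right_mono) auto
    then show ?thesis by (simp flip: exp_add)
  qed
  \<comment> \<open>7/10 bounds ln 2, and the summand \<open>l\<close> is the cost of centring,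
    since \<open>\<bar>\<mu>\<bar> \<le> 1\<close>. At \<open>l = 3\<close> the exponent is 119/20,
    just below the target 6.\<close>
  have large: "K l \<le> exp (7/10 + l^2/4 + l)" if "l \<ge> 0" for l
  proof -
    have "exp (l * X \<omega>) \<le> exp (l^2/4) * exp ((X \<omega>)^2)" for \<omega>
      using zero_le_power2[of "l/2 - X \<omega>"] by (simp add: power2_eq_square algebra_simps flip: exp_add)
    then have "expectation (\<lambda>\<omega>. exp (l * X \<omega>)) \<le> expectation (\<lambda>\<omega>. exp (l^2/4) * exp ((X \<omega>)^2))"
      using mom by (intro integral_mono) auto
    also have "\<dots> \<le> exp (l^2/4) * 2" using mom by simp
    also have "\<dots> \<le> exp (l^2/4) * exp (7/10)"
    proof -
      have "exp (ln (2::real)) \<le> exp (7/10)" using ln2_le_25_over_36 by (subst exp_le_cancel_iff) simp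
      then show ?thesis by simp
    qed
    finally have "expectation (\<lambda>\<omega>. exp (l * X \<omega>)) \<le> exp (l^2/4) * exp (7/10)" .
    moreover have "l * (- \<mu>) \<le> l * 1" using that \<mu> by (intro mult_left_mono) auto
    then have "exp (- (l * \<mu>)) \<le> exp l" by simp
    ultimately have "K l \<le> (exp (l^2/4) * exp (7/10)) * exp l"
      unfolding K by (intro mult_mono) auto
    then show ?thesis by (simp add: add_ac flip: exp_add)
  qed
  consider "l^2 \<le> 3/2" | "l^2 \<ge> 3/2" "l \<le> 2" | "2 \<le> l" "l \<le> 3" | "l \<ge> 3" by linarith
  then have "K l \<le> exp (2/3 * l\<^sup>2)"
  proof cases
    case 1
    then show ?thesis by (rule small)
  next
    case 2
    \<comment> \<open>The chord of the exponent from 0 at 0 to 8/5 at 2 has slope 4/5, and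
      \<open>4/5 * l \<le> 2/3 * l^2\<close> holds for positive \<open>l\<close> exactly from 6/5
      on.\<close>
    have "6/5 \<le> l"
    proof (rule ccontr)
      assume "\<not> 6/5 \<le> l"
      then have "l^2 \<le> (6/5)^2" using l by (intro power_mono) auto
      then show False using 2 by (simp add: power2_eq_square)
    qed
    have "K ((1 - l/2) * 0 + (l/2) * 2) \<le> exp ((1 - l/2) * 0 + (l/2) * (8/5))"
      unfolding K_def using two l 2 int[of 0] int[of 2] int[of l] by (intro expectation_exp_convex) (auto simp: K_def prob_space)
    also have "\<dots> \<le> exp (2/3*l^2)" using \<open>6/5 \<le> l\<close> by (simp add: power2_eq_square)
    finally show ?thesis by simp
  next
    case 3
    define s where "s = l - 2"
    have s: "0 \<le> s" "s \<le> 1" and ls: "l = (1-s)*2 + s*3" using 3 by (auto simp: s_def algebra_simps)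
    have "K 3 \<le> exp (119/20)" using large[of 3] by (simp add: power2_eq_square)
    then have "K ((1-s)*2 + s*3) \<le> exp ((1-s)*(8/5) + s*(119/20))"
      using two s unfolding K_def by (intro expectation_exp_convex int) auto
    \<comment> \<open>The gap between the exponents is 2/3 * (s - 5/4)^2 + 1/40 - s/60.\<close>
    also have "\<dots> \<le> exp (2/3*l^2)"
      using zero_le_power2[of "s - 5/4"] s by (simp add: ls power2_eq_square field_simps)
    finally show ?thesis by (simp add: ls)
  next
    case 4
    have "l * 3 \<le> l^2" using 4 by (simp add: power2_eq_square)
    then have "7/10 + l^2/4 + l \<le> 2/3*l^2" using 4 by simp
    then have "exp (7/10 + l^2/4 + l) \<le> exp (2/3*l^2)" by (subst exp_le_cancel_iff)
    then show ?thesis using large[OF l] by linarith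
  qed
  then show ?thesis by (simp add: K_def \<mu>_def)
qed

text \<open>Negative \<open>l\<close> reduces to the nonnegative case because the hypothesis is
  invariant under changing the sign of \<open>X\<close>. The form as a nonnegative integral fits the
  product formula for independent variables.\<close>

lemma (in prob_space) psi2_bounded_mgf:
  fixes X :: "'a \<Rightarrow> real"
  assumes X: "random_variable borel X"
    and psi: "(\<integral>\<^sup>+ \<omega>. ennreal (exp ((X \<omega>)\<^sup>2)) \<partial>M) \<le> 2"
  shows "(\<integral>\<^sup>+ \<omega>. ennreal (exp (l * (X \<omega> - expectation X))) \<partial>M) \<le> ennreal (exp (2/3 * l\<^sup>2))"
proof -
  note [measurable] = X
  have "integrable M (\<lambda>\<omega>. exp (l * (X \<omega> - expectation X)))"
    using psi2_bounded_moments(7)[OF assms, of l] by (simp add: right_diff_distrib exp_diff)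
  moreover have "expectation (\<lambda>\<omega>. exp (l * (X \<omega> - expectation X))) \<le> exp (2/3 * l\<^sup>2)"
  proof (cases "l \<ge> 0")
    case True
    then show ?thesis using psi2_bounded_mgf_nonneg[OF assms] by simp
  next
    case False
    then show ?thesis using psi2_bounded_mgf_nonneg[of "\<lambda>\<omega>. - X \<omega>" "-l"] psi by (simp add: algebra_simps)
  qed
  ultimately show ?thesis by (subst nn_integral_eq_integral) (auto intro: ennreal_leI)
qed

section \<open>From the Orlicz norm to the exponential moment at its upper bound\<close>

lemma psi2_norm_nonneg: "0 \<le> psi2_norm M X"
  unfolding psi2_norm_def by (intro Inf_greatest) auto

text \<open>The infimum only yields the bound at every \<open>t > \<sigma>\<close>. Fatou's lemma
  along a sequence decreasing to \<sigma> carries it over to \<sigma> itself.\<close>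

lemma psi2_norm_leD:
  assumes [measurable]: "X \<in> borel_measurable M"
    and le: "psi2_norm M X \<le> ereal \<sigma>" and \<sigma>: "\<sigma> > 0"
  shows "(\<integral>\<^sup>+ \<omega>. ennreal (exp ((X \<omega> / \<sigma>)\<^sup>2)) \<partial>M) \<le> 2"
proof -
  have above: "(\<integral>\<^sup>+ \<omega>. ennreal (exp ((X \<omega> / t)\<^sup>2)) \<partial>M) \<le> 2" if "t > \<sigma>" for t
  proof -
    have "psi2_norm M X < ereal t" using le that by (simp add: le_less_trans)
    then obtain s where s: "s > 0" "s < t" "(\<integral>\<^sup>+ \<omega>. ennreal (exp ((X \<omega>)\<^sup>2 / s\<^sup>2)) \<partial>M) \<le> 2"
      unfolding psi2_norm_def Inf_less_iff by auto
    have "(\<integral>\<^sup>+ \<omega>. ennreal (exp ((X \<omega> / t)\<^sup>2)) \<partial>M) \<le> (\<integral>\<^sup>+ \<omega>. ennreal (exp ((X \<omega>)\<^sup>2 / s\<^sup>2)) \<partial>M)"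
      using s by (intro nn_integral_mono ennreal_leI)
        (auto simp: power_divide intro!: divide_left_mono power_mono)
    then show ?thesis using s(3) by simp
  qed
  define t where "t n = \<sigma> + inverse (real (Suc n))" for n
  have t: "t n > \<sigma>" for n by (simp add: t_def)
  have "t \<longlonglongrightarrow> \<sigma> + 0" unfolding t_def by (intro tendsto_intros LIMSEQ_inverse_real_of_nat)
  then have lim: "(\<lambda>n. ennreal (exp ((X \<omega> / t n)\<^sup>2))) \<longlonglongrightarrow> ennreal (exp ((X \<omega> / \<sigma>)\<^sup>2))" for \<omega>
    using \<sigma> by (intro tendsto_intros) auto
  have "(\<integral>\<^sup>+ \<omega>. ennreal (exp ((X \<omega> / \<sigma>)\<^sup>2)) \<partial>M) = (\<integral>\<^sup>+ \<omega>. liminf (\<lambda>n. ennreal (exp ((X \<omega> / t n)\<^sup>2))) \<partial>M)"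
    by (intro nn_integral_cong lim_imp_Liminf[symmetric] lim) simp
  also have "\<dots> \<le> liminf (\<lambda>n. \<integral>\<^sup>+ \<omega>. ennreal (exp ((X \<omega> / t n)\<^sup>2)) \<partial>M)"
    by (intro nn_integral_liminf) simp
  also have "\<dots> \<le> liminf (\<lambda>n::nat. 2)"
    by (intro Liminf_mono always_eventually allI above t)
  also have "\<dots> = (2::ennreal)" by (intro Liminf_const) simp
  finally show ?thesis .
qed

lemma (in prob_space) psi2_bounded_mgf_scaled:
  fixes X :: "'a \<Rightarrow> real"
  assumes [measurable]: "random_variable borel X" and \<sigma>: "\<sigma> > 0"
    and psi: "(\<integral>\<^sup>+ \<omega>. ennreal (exp ((X \<omega> / \<sigma>)\<^sup>2)) \<partial>M) \<le> 2"
  shows "(\<integral>\<^sup>+ \<omega>. ennreal (exp (l * (X \<omega> - expectation X))) \<partial>M) \<le> ennreal (exp (2/3 * (l * \<sigma>)\<^sup>2))"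
proof -
  have "l * \<sigma> * (X \<omega> / \<sigma> - expectation (\<lambda>\<omega>. X \<omega> / \<sigma>)) = l * (X \<omega> - expectation X)" for \<omega>
    using \<sigma> by (simp add: field_simps)
  note eq = this
  show ?thesis
    using psi2_bounded_mgf[of "\<lambda>\<omega>. X \<omega> / \<sigma>" "l * \<sigma>"] psi unfolding eq by simp
qed

section \<open>Chernoff bounds for weighted sums\<close>

lemma (in prob_space) psi2_sum_tail:
  fixes X :: "'i \<Rightarrow> 'a \<Rightarrow> real"
  assumes I: "finite I" "indep_vars (\<lambda>_. borel) X I" and \<sigma>: "\<sigma> > 0" and u: "u > 0"
    and psi: "\<And>i. i \<in> I \<Longrightarrow> (\<integral>\<^sup>+ \<omega>. ennreal (exp ((X i \<omega> / \<sigma>)\<^sup>2)) \<partial>M) \<le> 2"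
    and a: "(\<Sum>i\<in>I. (a i)\<^sup>2) = 1"
  shows "prob {\<omega>\<in>space M. u \<le> (\<Sum>i\<in>I. a i * (X i \<omega> - expectation (X i)))} \<le> exp (- 3 * u\<^sup>2 / (8 * \<sigma>\<^sup>2))"
proof -
  have rv[measurable]: "random_variable borel (X i)" if "i \<in> I" for i
    using I that unfolding indep_vars_def by blast
  \<comment> \<open>The minimiser of \<open>- l * u + 2/3 * l\<^sup>2 * \<sigma>\<^sup>2\<close>;
    the minimum is the exponent in the claim.\<close>
  define l where "l = 3 * u / (4 * \<sigma>\<^sup>2)"
  have l: "l > 0" using u \<sigma> by (simp add: l_def)
  let ?Y = "\<lambda>i \<omega>. a i * (X i \<omega> - expectation (X i))"
  have "ennreal (prob {\<omega>\<in>space M. u \<le> (\<Sum>i\<in>I. ?Y i \<omega>)}) = emeasure M {\<omega>\<in>space M. u \<le> (\<Sum>i\<in>I. ?Y i \<omega>)}"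
    by (simp add: emeasure_eq_measure)
  also have "\<dots> \<le> ennreal (exp (-l*u)) * (\<integral>\<^sup>+\<omega>\<in>space M. exp (l * (\<Sum>i\<in>I. ?Y i \<omega>)) \<partial>M)"
    by (intro Chernoff_ineq_nn_integral_ge l) auto
  also have "(\<integral>\<^sup>+\<omega>\<in>space M. exp (l * (\<Sum>i\<in>I. ?Y i \<omega>)) \<partial>M) = (\<integral>\<^sup>+\<omega>. (\<Prod>i\<in>I. ennreal (exp (l * a i * (X i \<omega> - expectation (X i))))) \<partial>M)"
    by (intro nn_integral_cong) (simp_all add: sum_distrib_left exp_sum I prod_ennreal mult.assoc)
  also have "\<dots> = (\<Prod>i\<in>I. \<integral>\<^sup>+\<omega>. ennreal (exp (l * a i * (X i \<omega> - expectation (X i)))) \<partial>M)"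
    by (intro indep_vars_nn_integral I indep_vars_compose2[OF I(2)]) auto
  also have "ennreal (exp (-l*u)) * \<dots> \<le> ennreal (exp (-l*u)) * (\<Prod>i\<in>I. ennreal (exp (2/3 * (l * a i * \<sigma>)\<^sup>2)))"
    by (intro mult_left_mono prod_mono_ennreal psi2_bounded_mgf_scaled \<sigma> psi rv) auto
  also have "\<dots> = ennreal (exp (-l*u) * exp (\<Sum>i\<in>I. 2/3 * (l * a i * \<sigma>)\<^sup>2))"
    by (simp add: prod_ennreal prod_nonneg exp_sum I flip: ennreal_mult)
  also have "(\<Sum>i\<in>I. 2/3 * (l * a i * \<sigma>)\<^sup>2) = 2/3 * l\<^sup>2 * \<sigma>\<^sup>2 * (\<Sum>i\<in>I. (a i)\<^sup>2)"
    by (simp add: sum_distrib_left power_mult_distrib mult_ac)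
  also have "exp (-l*u) * exp (2/3 * l\<^sup>2 * \<sigma>\<^sup>2 * (\<Sum>i\<in>I. (a i)\<^sup>2)) = exp (-l*u + 2/3 * l\<^sup>2 * \<sigma>\<^sup>2)"
    by (simp only: a exp_add mult_1_right)
  also have "-l*u + 2/3 * l\<^sup>2 * \<sigma>\<^sup>2 = - 3 * u\<^sup>2 / (8 * \<sigma>\<^sup>2)"
    using \<sigma> by (simp add: l_def power2_eq_square field_simps)
  finally show ?thesis by simp
qed

text \<open>Changing the sign of all weights keeps their Euclidean norm, so both tails obey the
  one-sided bound.\<close>

lemma (in prob_space) psi2_sum_tail_abs:
  fixes X :: "'i \<Rightarrow> 'a \<Rightarrow> real"
  assumes I: "finite I" "indep_vars (\<lambda>_. borel) X I" and \<sigma>: "\<sigma> > 0" and u: "u > 0"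
    and psi: "\<And>i. i \<in> I \<Longrightarrow> (\<integral>\<^sup>+ \<omega>. ennreal (exp ((X i \<omega> / \<sigma>)\<^sup>2)) \<partial>M) \<le> 2"
    and a: "(\<Sum>i\<in>I. (a i)\<^sup>2) = 1"
  shows "prob {\<omega>\<in>space M. u \<le> \<bar>\<Sum>i\<in>I. a i * (X i \<omega> - expectation (X i))\<bar>} \<le> 2 * exp (- 3 * u\<^sup>2 / (8 * \<sigma>\<^sup>2))"
proof -
  have rv: "random_variable borel (X i)" if "i \<in> I" for i
    using I that unfolding indep_vars_def by blast
  let ?S = "\<lambda>a \<omega>. \<Sum>i\<in>I. a i * (X i \<omega> - expectation (X i))"
  have "?S b \<in> borel_measurable M" for b
    by (intro borel_measurable_sum borel_measurable_times borel_measurable_diff borel_measurable_const rv)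
  then have sets: "{\<omega>\<in>space M. u \<le> ?S b \<omega>} \<in> sets M" for b
    by (intro borel_measurable_le borel_measurable_const)
  have tail: "prob {\<omega>\<in>space M. u \<le> ?S b \<omega>} \<le> exp (- 3 * u\<^sup>2 / (8 * \<sigma>\<^sup>2))"
    if "(\<Sum>i\<in>I. (b i)\<^sup>2) = 1" for b
    using psi2_sum_tail[OF I \<sigma> u psi that] .
  have neg: "?S (\<lambda>i. - a i) \<omega> = - ?S a \<omega>" for \<omega> by (simp add: sum_negf)
  have "{\<omega>\<in>space M. u \<le> \<bar>?S a \<omega>\<bar>} = {\<omega>\<in>space M. u \<le> ?S a \<omega>} \<union> {\<omega>\<in>space M. u \<le> ?S (\<lambda>i. - a i) \<omega>}"
    unfolding neg by (auto simp: abs_if split: if_splits)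
  then have "prob {\<omega>\<in>space M. u \<le> \<bar>?S a \<omega>\<bar>} = prob ({\<omega>\<in>space M. u \<le> ?S a \<omega>} \<union> {\<omega>\<in>space M. u \<le> ?S (\<lambda>i. - a i) \<omega>})"
    by (rule arg_cong)
  also have "\<dots> \<le> prob {\<omega>\<in>space M. u \<le> ?S a \<omega>} + prob {\<omega>\<in>space M. u \<le> ?S (\<lambda>i. - a i) \<omega>}"
    by (rule measure_Un_le; rule sets)
  also have "\<dots> \<le> exp (- 3 * u\<^sup>2 / (8 * \<sigma>\<^sup>2)) + exp (- 3 * u\<^sup>2 / (8 * \<sigma>\<^sup>2))"
    by (rule add_mono; rule tail) (simp_all add: a)
  finally show ?thesis by simp
qed

section \<open>The CUSUM statistic and the stopping time\<close>

text \<open>For \<open>0 < s < t\<close> these are the coefficients on \<open>{1..t}\<close> of the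
  linear form whose absolute value is the CUSUM: a unit vector, orthogonal to constants, that takes
  one value on each side of the split.\<close>

definition cusum_weight :: "nat \<Rightarrow> nat \<Rightarrow> nat \<Rightarrow> real" where
  "cusum_weight s t l =
     (if l \<le> s then sqrt ((real t - real s) / (real t * real s))
      else - sqrt (real s / (real t * (real t - real s))))"

lemma sum_cusum_weight:
  assumes "s \<le> t"
  shows "(\<Sum>l=1..t. cusum_weight s t l * x l) =
     sqrt ((real t - real s) / (real t * real s)) * (\<Sum>l=1..s. x l)
      - sqrt (real s / (real t * (real t - real s))) * (\<Sum>l=s+1..t. x l)"
proof -
  have "{1..t} = {1..s} \<union> {s+1..t}" using assms by auto
  then have "(\<Sum>l=1..t. cusum_weight s t l * x l) =
      (\<Sum>l=1..s. cusum_weight s t l * x l) + (\<Sum>l=s+1..t. cusum_weight s t l * x l)"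
    by (simp add: sum.union_disjoint)
  also have "(\<Sum>l=1..s. cusum_weight s t l * x l) = (\<Sum>l=1..s. sqrt ((real t - real s) / (real t * real s)) * x l)"
    by (intro sum.cong) (auto simp: cusum_weight_def)
  also have "(\<Sum>l=s+1..t. cusum_weight s t l * x l) = (\<Sum>l=s+1..t. - sqrt (real s / (real t * (real t - real s))) * x l)"
    by (intro sum.cong) (auto simp: cusum_weight_def)
  finally show ?thesis by (simp add: sum_distrib_left sum_negf)
qed

lemma cusum_eq_abs_sum: "s \<le> t \<Longrightarrow> cusum x s t = \<bar>\<Sum>l=1..t. cusum_weight s t l * x l\<bar>"
  unfolding cusum_def by (subst sum_cusum_weight) auto

text \<open>Serves twice: as the size of the signal when the split sits at the change, and, with
  \<open>p = q\<close>, as the cancellation of a constant mean.\<close>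

lemma sum_cusum_weight_two_levels:
  assumes st: "0 < s" "s < t"
    and 1: "\<And>l. 1 \<le> l \<Longrightarrow> l \<le> s \<Longrightarrow> f l = p" and 2: "\<And>l. s < l \<Longrightarrow> l \<le> t \<Longrightarrow> f l = q"
  shows "(\<Sum>l=1..t. cusum_weight s t l * f l) = sqrt (real s * (real t - real s) / real t) * (p - q)"
proof -
  have e: "sqrt (b / (c * a)) * a = sqrt (a * b / c)" if "a > 0" for a b c :: real
  proof -
    have "sqrt (b / (c * a)) * a = sqrt (b / (c * a)) * sqrt (a^2)" using that by simp
    also have "\<dots> = sqrt (b / (c * a) * a^2)" by (simp only: real_sqrt_mult)
    also have "b / (c * a) * a^2 = a * b / c" using that by (simp add: power2_eq_square)
    finally show ?thesis .
  qed
  have "(\<Sum>l=1..s. f l) = real s * p" "(\<Sum>l=s+1..t. f l) = (real t - real s) * q"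
    using 1 2 st by (simp_all add: of_nat_diff)
  then have "(\<Sum>l=1..t. cusum_weight s t l * f l) =
      sqrt ((real t - real s) / (real t * real s)) * real s * p
      - sqrt (real s / (real t * (real t - real s))) * (real t - real s) * q"
    using st by (subst sum_cusum_weight) auto
  also have "\<dots> = sqrt (real s * (real t - real s) / real t) * (p - q)"
    using st by (subst (1 2) e) (auto simp: algebra_simps)
  finally show ?thesis .
qed

lemma sum_cusum_weight_squares:
  assumes st: "0 < s" "s < t"
  shows "(\<Sum>l=1..t. (cusum_weight s t l)\<^sup>2) = 1"
proof -
  let ?A = "(real t - real s) / (real t * real s)" and ?B = "real s / (real t * (real t - real s))"
  have "{1..t} = {1..s} \<union> {s+1..t}" using assms by auto
  then have "(\<Sum>l=1..t. (cusum_weight s t l)\<^sup>2) =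
      (\<Sum>l=1..s. (cusum_weight s t l)\<^sup>2) + (\<Sum>l=s+1..t. (cusum_weight s t l)\<^sup>2)"
    by (simp add: sum.union_disjoint)
  also have "(\<Sum>l=1..s. (cusum_weight s t l)\<^sup>2) = (\<Sum>l=1..s. ?A)"
    using st by (intro sum.cong) (auto simp: cusum_weight_def)
  also have "(\<Sum>l=s+1..t. (cusum_weight s t l)\<^sup>2) = (\<Sum>l=s+1..t. ?B)"
    using st by (intro sum.cong) (auto simp: cusum_weight_def)
  also have "(\<Sum>l=1..s. ?A) + (\<Sum>l=s+1..t. ?B) = real s * ?A + (real t - real s) * ?B"
    using st by (simp add: of_nat_diff)
  also have "\<dots> = 1" using st by (simp add: field_simps)
  finally show ?thesis .
qed

section \<open>The stopping time and its dyadic windows\<close>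

definition alarm_at :: "real \<Rightarrow> real \<Rightarrow> (nat \<Rightarrow> real) \<Rightarrow> nat \<Rightarrow> bool" where
  "alarm_at \<sigma> \<alpha> x t \<longleftrightarrow>
     (\<exists>j\<in>{1..nat \<lfloor>ln (real t) / ln 2\<rfloor>}. cusum x (t - 2 ^ (j - 1)) t > threshold \<sigma> \<alpha> t)"

lemma enat_Inf_image_le_iff: "Inf (enat ` S) \<le> enat n \<longleftrightarrow> (\<exists>t\<in>S. t \<le> n)"
proof
  assume le: "Inf (enat ` S) \<le> enat n"
  then have "enat ` S \<noteq> {}" by (auto simp: Inf_enat_def)
  then have "Inf (enat ` S) \<in> enat ` S" unfolding Inf_enat_def by (auto intro: LeastI)
  then show "\<exists>t\<in>S. t \<le> n" using le by auto
next
  assume "\<exists>t\<in>S. t \<le> n"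
  then show "Inf (enat ` S) \<le> enat n" by (meson INF_lower2 enat_ord_simps(1))
qed

lemma detection_time_le_iff:
  "detection_time \<sigma> \<alpha> x \<le> enat n \<longleftrightarrow> (\<exists>t\<in>{2..n}. alarm_at \<sigma> \<alpha> x t)"
  by (auto simp: detection_time_def enat_Inf_image_le_iff alarm_at_def)

lemma detection_time_finite_iff:
  "detection_time \<sigma> \<alpha> x < \<infinity> \<longleftrightarrow> (\<exists>t\<ge>2. alarm_at \<sigma> \<alpha> x t)"
proof -
  have "detection_time \<sigma> \<alpha> x < \<infinity> \<longleftrightarrow> (\<exists>n. detection_time \<sigma> \<alpha> x \<le> enat n)"
    by (cases "detection_time \<sigma> \<alpha> x") auto
  also have "\<dots> \<longleftrightarrow> (\<exists>t\<ge>2. alarm_at \<sigma> \<alpha> x t)"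
    unfolding detection_time_le_iff by (meson atLeastAtMost_iff order_refl)
  finally show ?thesis .
qed

text \<open>Every window covers at most half of the data. Hence the split point
  \<open>t - 2 ^ (j - 1)\<close> is not truncated and lies strictly between 0 and \<open>t\<close>,
  as the weight identities require.\<close>

lemma alarm_window_bounds:
  assumes j: "j \<in> {1..nat \<lfloor>ln (real t) / ln 2\<rfloor>}" and t: "t \<ge> 2"
  shows "2 * 2 ^ (j - 1) \<le> t"
proof -
  have "int j \<le> \<lfloor>ln (real t) / ln 2\<rfloor>" using j by auto
  then have "real j \<le> log 2 (real t)" unfolding le_floor_iff by (simp add: log_def)
  then have "2 ^ j \<le> real t" using t by (simp add: le_log_iff powr_realpow)
  then have "2 ^ j \<le> t" by (metis of_nat_le_iff of_nat_numeral of_nat_power)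
  moreover have "(2::nat) ^ j = 2 * 2 ^ (j - 1)" using j by (cases j) auto
  ultimately show ?thesis by simp
qed

text \<open>The converse direction, which shows that the window starting right after the change is
  among those inspected. The index is \<open>Suc k\<close> because index \<open>j\<close> stands for
  length \<open>2 ^ (j - 1)\<close>.\<close>

lemma alarm_window_exists:
  assumes "2 * 2 ^ k \<le> t" "t \<ge> 2"
  shows "Suc k \<in> {1..nat \<lfloor>ln (real t) / ln 2\<rfloor>}"
proof -
  have "2 ^ Suc k \<le> real t" using assms by (metis of_nat_le_iff of_nat_numeral of_nat_power power_Suc)
  then have "real (Suc k) \<le> log 2 (real t)" using assms by (subst le_log_iff) (auto simp: powr_realpow simp del: of_nat_Suc)
  then have "int (Suc k) \<le> \<lfloor>ln (real t) / ln 2\<rfloor>" unfolding le_floor_iff by (simp add: log_def)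
  then show ?thesis by auto
qed

text \<open>The longest window has length at least the number of windows, by
  \<open>Suc k \<le> 2 ^ k\<close>, and fits into half of the data. The factor 2 gained here cancels
  the one from the two-sided tail.\<close>

lemma number_of_windows_le:
  assumes "t \<ge> 2"
  shows "2 * nat \<lfloor>ln (real t) / ln 2\<rfloor> \<le> t"
proof (cases "nat \<lfloor>ln (real t) / ln 2\<rfloor>")
  case (Suc k)
  have "Suc k \<le> 2 ^ k" by (simp add: Suc_leI)
  moreover have "2 * 2 ^ k \<le> t" using alarm_window_bounds[of "Suc k" t] Suc assms by simp
  ultimately show ?thesis using Suc by linarith
qed simp

text \<open>For the degenerate scale \<open>\<sigma> = 0\<close>: the second moment is at most
  \<open>s\<^sup>2\<close> for every positive \<open>s\<close>, hence zero.\<close>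

lemma (in prob_space) psi2_norm_zero_AE:
  fixes X :: "'a \<Rightarrow> real"
  assumes [measurable]: "random_variable borel X" and le: "psi2_norm M X \<le> 0"
  shows "AE \<omega> in M. X \<omega> = 0"
proof -
  have *: "integrable M (\<lambda>\<omega>. (X \<omega>)\<^sup>2) \<and> expectation (\<lambda>\<omega>. (X \<omega>)\<^sup>2) \<le> s\<^sup>2" if s: "s > 0" for s
  proof -
    have "psi2_norm M X \<le> ereal s" using le s by (meson ereal_less_eq(5) order_trans less_imp_le)
    then have psi: "(\<integral>\<^sup>+ \<omega>. ennreal (exp ((X \<omega> / s)\<^sup>2)) \<partial>M) \<le> 2"
      using s by (intro psi2_norm_leD) auto
    have "integrable M (\<lambda>\<omega>. s\<^sup>2 * (X \<omega> / s)\<^sup>2)"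
      using psi2_bounded_moments(4)[OF _ psi] by (intro integrable_mult_right) simp
    moreover have "(\<lambda>\<omega>. s\<^sup>2 * (X \<omega> / s)\<^sup>2) = (\<lambda>\<omega>. (X \<omega>)\<^sup>2)"
      using s by (simp add: power_divide)
    ultimately show ?thesis
      using psi2_bounded_moments(5)[OF _ psi] s by (simp add: power_divide field_simps)
  qed
  have int: "integrable M (\<lambda>\<omega>. (X \<omega>)\<^sup>2)" using *[of 1] by simp
  have "expectation (\<lambda>\<omega>. (X \<omega>)\<^sup>2) \<le> 0"
  proof (rule ccontr)
    assume c: "\<not> expectation (\<lambda>\<omega>. (X \<omega>)\<^sup>2) \<le> 0"
    then show False using *[of "sqrt (expectation (\<lambda>\<omega>. (X \<omega>)\<^sup>2) / 2)"] by simp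
  qed
  then have "expectation (\<lambda>\<omega>. (X \<omega>)\<^sup>2) = 0" by (intro antisym) auto
  then show ?thesis using int by (subst (asm) integral_nonneg_eq_0_iff_AE) auto
qed

text \<open>Telescoping, as 1/(n+1)^2 is at most 1/n - 1/(n+1). The deficit
  \<open>1 / real n\<close> is kept because it later pays for a missed detection.\<close>

lemma sum_inverse_square_le: "n \<ge> 1 \<Longrightarrow> (\<Sum>t=2..n. 1 / (real t)\<^sup>2) \<le> 1 - 1 / real n"
proof (induction n rule: dec_induct)
  case (step n)
  have "(\<Sum>t=2..Suc n. 1 / (real t)\<^sup>2) = (\<Sum>t=2..n. 1 / (real t)\<^sup>2) + 1 / (real (Suc n))\<^sup>2"
    using step by simp
  also have "1 / (real (Suc n))\<^sup>2 \<le> 1 / (real n * real (Suc n))"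
    using step by (intro divide_left_mono) (auto simp: power2_eq_square)
  also have "\<dots> = 1 / real n - 1 / real (Suc n)" using step by (simp add: field_simps)
  finally show ?case using step by simp
qed simp

section \<open>False alarms and detection delay\<close>

text \<open>The nondegenerate case, with the Orlicz bound already turned into an integral at scale
  \<sigma>.\<close>

locale psi2_bounded_sequence = prob_space M for M :: "'a measure" +
  fixes X :: "nat \<Rightarrow> 'a \<Rightarrow> real" and \<sigma> \<alpha> :: real
  assumes indep: "indep_vars (\<lambda>_. borel) X {1..}"
    and sigma: "\<sigma> > 0"
    and alpha: "0 < \<alpha>" "\<alpha> < 1"
    and psi: "\<And>i. i \<ge> 1 \<Longrightarrow> (\<integral>\<^sup>+ \<omega>. ennreal (exp ((X i \<omega> / \<sigma>)\<^sup>2)) \<partial>M) \<le> 2"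
begin

abbreviation mean :: "nat \<Rightarrow> real" where "mean i \<equiv> expectation (X i)"

abbreviation path :: "'a \<Rightarrow> nat \<Rightarrow> real" where "path \<omega> \<equiv> \<lambda>i. X i \<omega>"

lemma rv: "i \<ge> 1 \<Longrightarrow> random_variable borel (X i)"
  using indep unfolding indep_vars_def by auto

lemma measurable_cusum [measurable]: "(\<lambda>\<omega>. cusum (path \<omega>) s t) \<in> borel_measurable M"
  unfolding cusum_def
  by (intro borel_measurable_abs borel_measurable_diff borel_measurable_times borel_measurable_sum borel_measurable_const rv)
    auto

lemma sets_alarm_at [measurable]: "{\<omega>\<in>space M. alarm_at \<sigma> \<alpha> (path \<omega>) t} \<in> sets M"
  unfolding alarm_at_def by measurable

text \<open>Limits a jump of the mean to \<open>2 * \<sigma>\<close>, which later keeps the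
  detection window at least one time step long.\<close>

lemma abs_mean_le:
  assumes "i \<ge> 1"
  shows "\<bar>mean i\<bar> \<le> \<sigma>"
proof -
  note [measurable] = rv[OF assms]
  show ?thesis
    using psi2_bounded_moments(6)[OF _ psi[OF assms]] sigma by (simp add: abs_divide)
qed

definition noise :: "nat \<Rightarrow> nat \<Rightarrow> 'a \<Rightarrow> real" where
  "noise s t \<omega> = (\<Sum>l=1..t. cusum_weight s t l * (X l \<omega> - mean l))"

lemma noise_tail:
  assumes "0 < s" "s < t" "u > 0"
  shows "prob {\<omega>\<in>space M. u \<le> \<bar>noise s t \<omega>\<bar>} \<le> 2 * exp (- 3 * u\<^sup>2 / (8 * \<sigma>\<^sup>2))"
  unfolding noise_def
  using assms by (intro psi2_sum_tail_abs sigma psi sum_cusum_weight_squares indep_vars_subset[OF indep]) auto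

lemma sets_noise_tail: "{\<omega>\<in>space M. u \<le> \<bar>noise s t \<omega>\<bar>} \<in> sets M"
proof -
  have [measurable]: "noise s t \<in> borel_measurable M"
    unfolding noise_def
    by (intro borel_measurable_diff borel_measurable_times borel_measurable_sum borel_measurable_const rv) auto
  show ?thesis by measurable
qed

section \<open>Signal, noise and false alarm probabilities\<close>

lemma cusum_eq_signal_plus_noise:
  assumes "s \<le> t"
  shows "cusum (path \<omega>) s t = \<bar>(\<Sum>l=1..t. cusum_weight s t l * mean l) + noise s t \<omega>\<bar>"
  using assms by (simp add: cusum_eq_abs_sum noise_def right_diff_distrib sum_subtractf)

lemma threshold_squared: "t \<ge> 1 \<Longrightarrow> (threshold \<sigma> \<alpha> t)\<^sup>2 = 8 * \<sigma>\<^sup>2 * ln (real t / \<alpha>)"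
proof -
  assume "t \<ge> 1"
  then have "ln (real t / \<alpha>) \<ge> 0" using alpha by simp
  moreover have "((2::real) powr (3/2))\<^sup>2 = 8" by (simp add: powr_power)
  ultimately show ?thesis by (simp add: threshold_def power_mult_distrib)
qed

lemma threshold_pos: "t \<ge> 1 \<Longrightarrow> threshold \<sigma> \<alpha> t > 0"
  using alpha sigma by (simp add: threshold_def)

text \<open>A constant mean leaves only noise. The squared threshold carries the factor 8 and the
  tail exponent the factor 3/8, so the cube of \<open>\<alpha> / real t\<close> results.\<close>

lemma cusum_false_alarm:
  assumes st: "0 < s" "s < t" and const: "\<And>l. 1 \<le> l \<Longrightarrow> l \<le> t \<Longrightarrow> mean l = c"
  shows "prob {\<omega>\<in>space M. threshold \<sigma> \<alpha> t < cusum (path \<omega>) s t} \<le> 2 * (\<alpha> / real t) ^ 3"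
proof -
  let ?b = "threshold \<sigma> \<alpha> t"
  have "(\<Sum>l=1..t. cusum_weight s t l * mean l) = sqrt (real s * (real t - real s) / real t) * (c - c)"
    using st const by (intro sum_cusum_weight_two_levels) auto
  then have "cusum (path \<omega>) s t = \<bar>noise s t \<omega>\<bar>" for \<omega>
    using st by (simp add: cusum_eq_signal_plus_noise)
  then have "prob {\<omega>\<in>space M. ?b < cusum (path \<omega>) s t} \<le> prob {\<omega>\<in>space M. ?b \<le> \<bar>noise s t \<omega>\<bar>}"
    by (intro finite_measure_mono sets_noise_tail) auto
  also have "\<dots> \<le> 2 * exp (- 3 * ?b\<^sup>2 / (8 * \<sigma>\<^sup>2))"
    using st by (intro noise_tail threshold_pos) auto
  also have "- 3 * ?b\<^sup>2 / (8 * \<sigma>\<^sup>2) = 3 * ln (\<alpha> / real t)"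
    using st sigma alpha by (simp add: threshold_squared ln_div field_simps)
  also have "exp (3 * ln (\<alpha> / real t)) = (\<alpha> / real t) ^ 3"
    using st alpha exp_of_nat_mult[of 3 "ln (\<alpha> / real t)"] by simp
  finally show ?thesis .
qed

lemma prob_alarm_at_le:
  assumes t: "t \<ge> 2" and const: "\<And>l. 1 \<le> l \<Longrightarrow> l \<le> t \<Longrightarrow> mean l = c"
  shows "prob {\<omega>\<in>space M. alarm_at \<sigma> \<alpha> (path \<omega>) t} \<le> \<alpha> ^ 3 / (real t)\<^sup>2"
proof -
  let ?J = "{1..nat \<lfloor>ln (real t) / ln 2\<rfloor>}"
  let ?A = "\<lambda>j. {\<omega>\<in>space M. threshold \<sigma> \<alpha> t < cusum (path \<omega>) (t - 2 ^ (j - 1)) t}"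
  have "{\<omega>\<in>space M. alarm_at \<sigma> \<alpha> (path \<omega>) t} = (\<Union>j\<in>?J. ?A j)"
    by (auto simp: alarm_at_def)
  also have "prob \<dots> \<le> (\<Sum>j\<in>?J. prob (?A j))"
    by (intro measure_UNION_le) auto
  also have "\<dots> \<le> (\<Sum>j\<in>?J. 2 * (\<alpha> / real t) ^ 3)"
  proof (intro sum_mono cusum_false_alarm[where c=c] const)
    fix j assume "j \<in> ?J"
    then have "2 * 2 ^ (j - 1) \<le> t" using t by (rule alarm_window_bounds)
    moreover have "(0::nat) < 2 ^ (j - 1)" by simp
    ultimately show "0 < t - 2 ^ (j - 1)" "t - 2 ^ (j - 1) < t" by linarith+
  qed
  also have "\<dots> = real (2 * nat \<lfloor>ln (real t) / ln 2\<rfloor>) * (\<alpha> / real t) ^ 3" by simp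
  also have "\<dots> \<le> real t * (\<alpha> / real t) ^ 3"
    using number_of_windows_le[OF t] alpha by (intro mult_right_mono) (simp_all only: of_nat_le_iff, simp)
  also have "\<dots> = \<alpha> ^ 3 / (real t)\<^sup>2" using t by (simp add: power2_eq_square power3_eq_cube)
  finally show ?thesis .
qed

lemma sets_alarm_before: "{\<omega>\<in>space M. \<exists>t\<in>{2..n}. alarm_at \<sigma> \<alpha> (path \<omega>) t} \<in> sets M"
  by measurable

lemma prob_alarm_before_le:
  assumes n: "n \<ge> 1" and const: "\<And>l. 1 \<le> l \<Longrightarrow> l \<le> n \<Longrightarrow> mean l = c"
  shows "prob {\<omega>\<in>space M. \<exists>t\<in>{2..n}. alarm_at \<sigma> \<alpha> (path \<omega>) t} \<le> \<alpha> ^ 3 * (1 - 1 / real n)"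
proof -
  have "{\<omega>\<in>space M. \<exists>t\<in>{2..n}. alarm_at \<sigma> \<alpha> (path \<omega>) t} = (\<Union>t\<in>{2..n}. {\<omega>\<in>space M. alarm_at \<sigma> \<alpha> (path \<omega>) t})"
    by auto
  also have "prob \<dots> \<le> (\<Sum>t=2..n. prob {\<omega>\<in>space M. alarm_at \<sigma> \<alpha> (path \<omega>) t})"
    by (intro measure_UNION_le) auto
  also have "\<dots> \<le> (\<Sum>t=2..n. \<alpha> ^ 3 * (1 / (real t)\<^sup>2))"
    using const by (intro sum_mono order_trans[OF prob_alarm_at_le[of _ c]]) auto
  also have "\<dots> = \<alpha> ^ 3 * (\<Sum>t=2..n. 1 / (real t)\<^sup>2)" by (simp only: sum_distrib_left)
  also have "\<dots> \<le> \<alpha> ^ 3 * (1 - 1 / real n)"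
    using n alpha by (intro mult_left_mono sum_inverse_square_le) auto
  finally show ?thesis .
qed

lemma alpha_cube_less: "\<alpha> ^ 3 < \<alpha>"
  using power_strict_decreasing[of 1 3 \<alpha>] alpha by simp

lemma false_alarm_before_change:
  assumes n: "n \<ge> 1" and const: "\<And>l. 1 \<le> l \<Longrightarrow> l \<le> n \<Longrightarrow> mean l = c"
  shows "prob {\<omega>\<in>space M. detection_time \<sigma> \<alpha> (path \<omega>) \<le> enat n} \<le> \<alpha> ^ 3 * (1 - 1 / real n)"
  using prob_alarm_before_le[OF assms] by (simp add: detection_time_le_iff)

text \<open>Continuity from below along growing horizons preserves only the weak bound by
  \<open>\<alpha> ^ 3\<close>; strictness comes from \<open>\<alpha> ^ 3 < \<alpha>\<close>.\<close>

lemma false_alarm_no_change: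
  assumes const: "\<And>l. 1 \<le> l \<Longrightarrow> mean l = c"
  shows "prob {\<omega>\<in>space M. detection_time \<sigma> \<alpha> (path \<omega>) < \<infinity>} < \<alpha>"
proof -
  let ?B = "\<lambda>n. {\<omega>\<in>space M. \<exists>t\<in>{2..n}. alarm_at \<sigma> \<alpha> (path \<omega>) t}"
  have "(\<lambda>n. prob (?B n)) \<longlonglongrightarrow> prob (\<Union>n. ?B n)"
    by (intro finite_Lim_measure_incseq) (auto simp: incseq_def intro!: sets_alarm_before)
  moreover have "prob (?B n) \<le> \<alpha> ^ 3" if "n \<ge> 1" for n
  proof -
    have "prob (?B n) \<le> \<alpha> ^ 3 * (1 - 1 / real n)" using that const by (intro prob_alarm_before_le) auto
    also have "\<dots> \<le> \<alpha> ^ 3 * 1" using alpha by (intro mult_left_mono) auto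
    finally show ?thesis by simp
  qed
  ultimately have "prob (\<Union>n. ?B n) \<le> \<alpha> ^ 3" by (intro LIMSEQ_le_const2) auto
  also have "(\<Union>n. ?B n) = {\<omega>\<in>space M. detection_time \<sigma> \<alpha> (path \<omega>) < \<infinity>}"
    unfolding detection_time_finite_iff by auto (meson atLeastAtMost_iff order_refl)
  finally show ?thesis using alpha_cube_less by simp
qed

text \<open>The assumption \<open>2 ^ k \<le> \<Delta>\<close> keeps the inspection time below
  \<open>2 * \<Delta>\<close>. This costs at most a factor 2 in the logarithm of the threshold and a
  factor 2 in the squared signal.\<close>

lemma missed_detection:
  assumes \<Delta>: "\<Delta> \<ge> 2" and w: "2 ^ k \<le> \<Delta>"
    and pre: "\<And>l. 1 \<le> l \<Longrightarrow> l \<le> \<Delta> \<Longrightarrow> mean l = p" and post: "\<And>l. l > \<Delta> \<Longrightarrow> mean l = q"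
    and snr: "128 * \<sigma>\<^sup>2 * ln (real \<Delta> / \<alpha>) \<le> 2 ^ k * (p - q)\<^sup>2"
  shows "prob {\<omega>\<in>space M. \<not> alarm_at \<sigma> \<alpha> (path \<omega>) (\<Delta> + 2 ^ k)} \<le> \<alpha> / real \<Delta>"
proof -
  define t where "t = \<Delta> + 2 ^ k"
  define L where "L = ln (real \<Delta> / \<alpha>)"
  define v where "v = 4 * \<sigma> * sqrt L"
  let ?m = "\<Sum>l=1..t. cusum_weight \<Delta> t l * mean l"
  have st: "0 < \<Delta>" "\<Delta> < t" "t \<le> 2 * \<Delta>" using \<Delta> w by (auto simp: t_def)
  have r: "0 < \<alpha> / real \<Delta>" "\<alpha> / real \<Delta> \<le> 1/2" "\<alpha> / real \<Delta> \<le> 1" using alpha \<Delta> by (auto simp: field_simps)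
  have L: "L > 0" using alpha \<Delta> by (simp add: L_def)
  have v: "v > 0" using L sigma by (simp add: v_def)
  have v2: "v\<^sup>2 = 16 * \<sigma>\<^sup>2 * L" using L by (simp add: v_def power_mult_distrib)
  \<comment> \<open>With \<Delta> at least 2 the extra ln 2 is at most \<open>L\<close>, so the
    logarithm at time \<open>t\<close> is at most \<open>2 * L\<close>; this is why \<open>v\<close>
    carries 16 = 2 * 8 under the square.\<close>
  have b: "threshold \<sigma> \<alpha> t \<le> v"
  proof (rule power2_le_imp_le)
    have "ln (real t / \<alpha>) \<le> ln (2 * (real \<Delta> / \<alpha>))"
      using st alpha by (subst ln_le_cancel_iff) (auto simp: field_simps)
    also have "\<dots> = ln 2 + L" using st alpha unfolding L_def by (subst ln_mult_pos) auto
    also have "ln 2 \<le> L" using \<Delta> alpha unfolding L_def by (subst ln_le_cancel_iff) (auto simp: field_simps)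
    finally have "8 * \<sigma>\<^sup>2 * ln (real t / \<alpha>) \<le> 8 * \<sigma>\<^sup>2 * (2 * L)" by (intro mult_left_mono) auto
    then show "(threshold \<sigma> \<alpha> t)\<^sup>2 \<le> v\<^sup>2" using st by (simp add: threshold_squared v2)
  qed (use v in simp)
  \<comment> \<open>Here 128 is used: half of it is 64, the factor in
    \<open>(2 * v)\<^sup>2 = 64 * \<sigma>\<^sup>2 * L\<close>.\<close>
  have m: "2 * v \<le> \<bar>?m\<bar>"
  proof (rule power2_le_imp_le)
    have "?m = sqrt (real \<Delta> * (real t - real \<Delta>) / real t) * (p - q)"
      using st pre post by (intro sum_cusum_weight_two_levels) auto
    then have "\<bar>?m\<bar>\<^sup>2 = real \<Delta> / real t * (2 ^ k * (p - q)\<^sup>2)"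
      by (simp add: power_mult_distrib t_def)
    also have "\<dots> \<ge> 1/2 * (128 * \<sigma>\<^sup>2 * L)"
      using snr st L by (intro mult_mono[of "1/2" _ "128 * \<sigma>\<^sup>2 * L"]) (auto simp: L_def field_simps)
    finally show "(2 * v)\<^sup>2 \<le> \<bar>?m\<bar>\<^sup>2" by (simp add: power_mult_distrib v2 mult.commute)
  qed simp
  have "v \<le> \<bar>noise \<Delta> t \<omega>\<bar>" if "\<not> alarm_at \<sigma> \<alpha> (path \<omega>) t" for \<omega>
  proof -
    have "Suc k \<in> {1..nat \<lfloor>ln (real t) / ln 2\<rfloor>}"
      using \<Delta> w by (intro alarm_window_exists) (auto simp: t_def)
    then have "\<not> cusum (path \<omega>) (t - 2 ^ (Suc k - 1)) t > threshold \<sigma> \<alpha> t"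
      using that unfolding alarm_at_def by blast
    then have "\<bar>?m + noise \<Delta> t \<omega>\<bar> \<le> threshold \<sigma> \<alpha> t"
      using st by (simp add: t_def cusum_eq_signal_plus_noise)
    then show ?thesis using b m by linarith
  qed
  then have "prob {\<omega>\<in>space M. \<not> alarm_at \<sigma> \<alpha> (path \<omega>) t} \<le> prob {\<omega>\<in>space M. v \<le> \<bar>noise \<Delta> t \<omega>\<bar>}"
    by (intro finite_measure_mono sets_noise_tail) auto
  also have "\<dots> \<le> 2 * exp (- 3 * v\<^sup>2 / (8 * \<sigma>\<^sup>2))" using st v by (intro noise_tail) auto
  also have "- 3 * v\<^sup>2 / (8 * \<sigma>\<^sup>2) = 6 * ln (\<alpha> / real \<Delta>)"
    using sigma alpha \<Delta> by (simp add: v2 L_def ln_div field_simps)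
  also have "exp (6 * ln (\<alpha> / real \<Delta>)) = (\<alpha> / real \<Delta>) ^ 6"
    using \<Delta> alpha exp_of_nat_mult[of 6 "ln (\<alpha> / real \<Delta>)"] by simp
  \<comment> \<open>Two of the six factors suffice: one is at most 1/2 and absorbs the leading 2,
    the other is the bound.\<close>
  also have "2 * (\<alpha> / real \<Delta>) ^ 6 \<le> 2 * (\<alpha> / real \<Delta>) ^ 2"
    using r by (intro mult_left_mono power_decreasing) auto
  also have "\<dots> = 2 * (\<alpha> / real \<Delta>) * (\<alpha> / real \<Delta>)" by (simp add: power2_eq_square)
  also have "\<dots> \<le> 2 * (1/2) * (\<alpha> / real \<Delta>)"
    using r by (intro mult_right_mono mult_left_mono) auto
  finally show ?thesis by (simp add: t_def)
qed

lemma detection_delay: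
  assumes \<Delta>: "\<Delta> \<ge> 2"
    and pre: "\<And>l. 1 \<le> l \<Longrightarrow> l \<le> \<Delta> \<Longrightarrow> mean l = p" and post: "\<And>l. l > \<Delta> \<Longrightarrow> mean l = q"
    and pq: "p \<noteq> q"
    and snr: "512 * ln (real \<Delta> / \<alpha>) \<le> real \<Delta> * (p - q)\<^sup>2 / \<sigma>\<^sup>2"
  shows "1 - \<alpha> \<le> prob {\<omega>\<in>space M. enat \<Delta> < detection_time \<sigma> \<alpha> (path \<omega>) \<and>
     ereal_of_enat (detection_time \<sigma> \<alpha> (path \<omega>))
       \<le> ereal (real \<Delta> + 256 * (\<sigma>\<^sup>2 * ln (real \<Delta> / \<alpha>) / (p - q)\<^sup>2))}"
proof -
  define L where "L = ln (real \<Delta> / \<alpha>)"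
  \<comment> \<open>256 = 2 * 128, since replacing \<open>h\<close> by a power of two may halve the
    window.\<close>
  define h where "h = 256 * (\<sigma>\<^sup>2 * L / (p - q)\<^sup>2)"
  have L: "L \<ge> 2/3"
  proof -
    have "ln 2 \<le> L" using \<Delta> alpha unfolding L_def by (subst ln_le_cancel_iff) (auto simp: field_simps)
    then show ?thesis using ln2_ge_two_thirds by linarith
  qed
  have pq2: "(p - q)\<^sup>2 > 0" using pq by simp
  \<comment> \<open>The delay has to leave room for at least one observation after the change. Here
    \<open>L \<ge> 2/3\<close>, which rests on \<Delta> being at least 2, meets the bound on the
    jump.\<close>
  have h1: "h \<ge> 1"
  proof -
    have "\<bar>p - q\<bar> \<le> 2 * \<sigma>"
      using abs_mean_le[of 1] abs_mean_le[of "Suc \<Delta>"] pre[of 1] post[of "Suc \<Delta>"] \<Delta> by auto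
    then have "(p - q)\<^sup>2 \<le> (2 * \<sigma>)\<^sup>2" by (metis abs_le_square_iff abs_of_nonneg abs_ge_zero order_trans)
    also have "\<dots> \<le> \<sigma>\<^sup>2 * (256 * L)" using L sigma by (simp add: power_mult_distrib)
    finally show ?thesis using pq2 by (simp add: h_def field_simps)
  qed
  \<comment> \<open>The signal-to-noise condition enters here: the window after the change is no
    longer than the stretch before it.\<close>
  have h2: "h \<le> real \<Delta>"
  proof -
    have "256 * (\<sigma>\<^sup>2 * L) \<le> 512 * (\<sigma>\<^sup>2 * L)" using L by simp
    also have "\<dots> \<le> real \<Delta> * (p - q)\<^sup>2" using snr sigma by (simp add: L_def field_simps)
    finally show ?thesis using pq2 by (simp add: h_def field_simps)
  qed
  obtain k where k: "2 ^ k \<le> nat \<lfloor>h\<rfloor>" "nat \<lfloor>h\<rfloor> < 2 ^ (k + 1)"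
    using ex_power_ivl1[of 2 "nat \<lfloor>h\<rfloor>"] h1 by (auto simp: le_nat_iff)
  have kh: "2 ^ k \<le> h" "h \<le> 2 * 2 ^ k"
  proof -
    have "real (2 ^ k) \<le> real (nat \<lfloor>h\<rfloor>)" using k by (simp only: of_nat_le_iff)
    then show "2 ^ k \<le> h" using h1 by (simp add: le_floor_iff)
    have "h \<le> real_of_int \<lfloor>h\<rfloor> + 1" by (rule real_of_int_floor_add_one_ge)
    also have "\<dots> = real (nat \<lfloor>h\<rfloor> + 1)" using h1 by simp
    also have "\<dots> \<le> real (2 ^ (k + 1))" using k by (subst of_nat_le_iff) simp
    finally show "h \<le> 2 * 2 ^ k" by simp
  qed
  have k\<Delta>: "2 ^ k \<le> \<Delta>"
  proof -
    have "(2::real) ^ k \<le> real \<Delta>" using kh h2 by linarith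
    then show ?thesis by simp
  qed
  let ?A = "{\<omega>\<in>space M. detection_time \<sigma> \<alpha> (path \<omega>) \<le> enat \<Delta>}"
  let ?B = "{\<omega>\<in>space M. \<not> alarm_at \<sigma> \<alpha> (path \<omega>) (\<Delta> + 2 ^ k)}"
  let ?G = "{\<omega>\<in>space M. enat \<Delta> < detection_time \<sigma> \<alpha> (path \<omega>) \<and>
     ereal_of_enat (detection_time \<sigma> \<alpha> (path \<omega>)) \<le> ereal (real \<Delta> + h)}"
  \<comment> \<open>Rounding the real bound down turns the event into one about
    \<open>detection_time\<close> and an \<open>enat\<close>, which is measurable through the
    alarms.\<close>
  have floor_window: "int n \<le> int \<Delta> + \<lfloor>h\<rfloor> \<longleftrightarrow> real n \<le> real \<Delta> + h" for n
    using le_floor_iff[of "int n - int \<Delta>" h] by (auto simp: algebra_simps)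
  have window: "ereal_of_enat T \<le> ereal (real \<Delta> + h) \<longleftrightarrow> T \<le> enat (nat \<lfloor>real \<Delta> + h\<rfloor>)" for T
    using h1 floor_window by (cases T) (auto simp: le_nat_iff)
  have [measurable]: "?A \<in> sets M" "?B \<in> sets M" by (simp_all add: detection_time_le_iff)
  have [measurable]: "?G \<in> sets M"
    unfolding window not_le[symmetric] detection_time_le_iff by measurable
  \<comment> \<open>Together with \<open>\<alpha> / real \<Delta>\<close> for a miss this adds up to
    exactly \<alpha>.\<close>
  have "prob ?A \<le> \<alpha> * (1 - 1 / real \<Delta>)"
  proof -
    have "prob ?A \<le> \<alpha> ^ 3 * (1 - 1 / real \<Delta>)" using \<Delta> pre by (intro false_alarm_before_change) auto
    also have "\<dots> \<le> \<alpha> * (1 - 1 / real \<Delta>)" using alpha_cube_less \<Delta> by (intro mult_right_mono) auto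
    finally show ?thesis .
  qed
  moreover have "prob ?B \<le> \<alpha> / real \<Delta>"
  proof (rule missed_detection[OF \<Delta> k\<Delta> pre post])
    have "256 * \<sigma>\<^sup>2 * L = h * (p - q)\<^sup>2" using pq2 by (simp add: h_def)
    also have "\<dots> \<le> 2 * 2 ^ k * (p - q)\<^sup>2" using kh by (intro mult_right_mono) auto
    finally show "128 * \<sigma>\<^sup>2 * ln (real \<Delta> / \<alpha>) \<le> 2 ^ k * (p - q)\<^sup>2" by (simp add: L_def)
  qed
  moreover have "prob (?A \<union> ?B) \<le> prob ?A + prob ?B" by (intro measure_Un_le) auto
  ultimately have "prob (?A \<union> ?B) \<le> \<alpha>" by (simp add: algebra_simps)
  moreover have "space M - (?A \<union> ?B) \<subseteq> ?G"
  proof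
    fix \<omega> assume \<omega>: "\<omega> \<in> space M - (?A \<union> ?B)"
    then have "alarm_at \<sigma> \<alpha> (path \<omega>) (\<Delta> + 2 ^ k)" by auto
    then have "detection_time \<sigma> \<alpha> (path \<omega>) \<le> enat (\<Delta> + 2 ^ k)"
      unfolding detection_time_le_iff using \<Delta> by (intro bexI[of _ "\<Delta> + 2 ^ k"]) auto
    also have "\<dots> \<le> enat (nat \<lfloor>real \<Delta> + h\<rfloor>)" using kh by (simp add: le_nat_iff le_floor_iff)
    finally show "\<omega> \<in> ?G" using \<omega> by (auto simp: window)
  qed
  then have "prob (space M - (?A \<union> ?B)) \<le> prob ?G" by (intro finite_measure_mono) auto
  moreover have "prob (space M - (?A \<union> ?B)) = 1 - prob (?A \<union> ?B)" by (intro prob_compl) auto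
  ultimately show ?thesis by (simp add: h_def L_def)
qed

end

text \<open>At scale 0 the threshold vanishes, and so does every CUSUM almost surely; an alarm asks
  for a strict excess and never occurs.\<close>

lemma (in prob_space) detection_time_infinite_of_zero:
  assumes "\<And>i. i \<ge> 1 \<Longrightarrow> AE \<omega> in M. X i \<omega> = 0"
  shows "prob {\<omega>\<in>space M. detection_time 0 \<alpha> (\<lambda>i. X i \<omega>) < \<infinity>} = 0"
proof -
  have "AE \<omega> in M. \<forall>i\<in>{1..}. X i \<omega> = 0" using assms by (subst AE_ball_countable) auto
  then have "AE \<omega> in M. \<not> detection_time 0 \<alpha> (\<lambda>i. X i \<omega>) < \<infinity>"
    unfolding detection_time_finite_iff by eventually_elim (auto simp: alarm_at_def cusum_def threshold_def)
  then obtain N where "{\<omega>\<in>space M. detection_time 0 \<alpha> (\<lambda>i. X i \<omega>) < \<infinity>} \<subseteq> N" "emeasure M N = 0" "N \<in> sets M"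
    by (elim AE_E) auto
  then show ?thesis
    by (metis (no_types, lifting) emeasure_eq_0 measure_eq_0_null_sets measure_def enn2real_0)
qed

theorem corollary5:
  shows "\<exists>C_SNR C_d :: real. C_SNR > 0 \<and> C_d > 0 \<and> C_d < C_SNR \<and>
    (\<forall>(M :: outcome measure) (X :: nat \<Rightarrow> outcome \<Rightarrow> real) (f :: nat \<Rightarrow> real)
       (\<sigma> :: real) (\<alpha> :: real).
       prob_space M \<and>
       prob_space.indep_vars M (\<lambda>_. borel) X {1..} \<and>
       (\<forall>i\<ge>1. prob_space.expectation M (X i) = f i) \<and>
       (SUP i\<in>{1..}. psi2_norm M (X i)) \<le> ereal \<sigma> \<and>
       0 < \<alpha> \<and> \<alpha> < 1 \<longrightarrow>
       ((\<forall>i\<ge>1. f i = f 1) \<longrightarrow>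
          \<P>(\<omega> in M. detection_time \<sigma> \<alpha> (\<lambda>i. X i \<omega>) < \<infinity>) < \<alpha>) \<and>
       (\<forall>\<Delta>\<ge>1.
          (\<forall>i\<in>{1..\<Delta>}. f i = f \<Delta>) \<and> f \<Delta> \<noteq> f (\<Delta> + 1) \<and> (\<forall>i\<ge>\<Delta> + 1. f i = f (\<Delta> + 1)) \<longrightarrow>
          \<P>(\<omega> in M. detection_time \<sigma> \<alpha> (\<lambda>i. X i \<omega>) \<le> enat \<Delta>) < \<alpha>) \<and>
       (\<forall>\<Delta>\<ge>2. \<forall>\<kappa>.
          (\<forall>i\<in>{1..\<Delta>}. f i = f \<Delta>) \<and> f \<Delta> \<noteq> f (\<Delta> + 1) \<and> (\<forall>i\<ge>\<Delta> + 1. f i = f (\<Delta> + 1)) \<and>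
          \<kappa> = \<bar>f \<Delta> - f (\<Delta> + 1)\<bar> \<and>
          real \<Delta> * \<kappa>\<^sup>2 / \<sigma>\<^sup>2 \<ge> C_SNR * ln (real \<Delta> / \<alpha>) \<longrightarrow>
          \<P>(\<omega> in M. enat \<Delta> < detection_time \<sigma> \<alpha> (\<lambda>i. X i \<omega>) \<and>
             ereal_of_enat (detection_time \<sigma> \<alpha> (\<lambda>i. X i \<omega>))
               \<le> ereal (real \<Delta> + C_d * (\<sigma>\<^sup>2 * ln (real \<Delta> / \<alpha>) / \<kappa>\<^sup>2))) \<ge> 1 - \<alpha>))"
proof (rule exI[of _ 512], rule exI[of _ 256], intro conjI)
  show "\<forall>(M :: outcome measure) (X :: nat \<Rightarrow> outcome \<Rightarrow> real) (f :: nat \<Rightarrow> real) (\<sigma> :: real) (\<alpha> :: real).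
       prob_space M \<and>
       prob_space.indep_vars M (\<lambda>_. borel) X {1..} \<and>
       (\<forall>i\<ge>1. prob_space.expectation M (X i) = f i) \<and>
       (SUP i\<in>{1..}. psi2_norm M (X i)) \<le> ereal \<sigma> \<and>
       0 < \<alpha> \<and> \<alpha> < 1 \<longrightarrow>
       ((\<forall>i\<ge>1. f i = f 1) \<longrightarrow>
          \<P>(\<omega> in M. detection_time \<sigma> \<alpha> (\<lambda>i. X i \<omega>) < \<infinity>) < \<alpha>) \<and>
       (\<forall>\<Delta>\<ge>1.
          (\<forall>i\<in>{1..\<Delta>}. f i = f \<Delta>) \<and> f \<Delta> \<noteq> f (\<Delta> + 1) \<and> (\<forall>i\<ge>\<Delta> + 1. f i = f (\<Delta> + 1)) \<longrightarrow>
          \<P>(\<omega> in M. detection_time \<sigma> \<alpha> (\<lambda>i. X i \<omega>) \<le> enat \<Delta>) < \<alpha>) \<and>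
       (\<forall>\<Delta>\<ge>2. \<forall>\<kappa>.
          (\<forall>i\<in>{1..\<Delta>}. f i = f \<Delta>) \<and> f \<Delta> \<noteq> f (\<Delta> + 1) \<and> (\<forall>i\<ge>\<Delta> + 1. f i = f (\<Delta> + 1)) \<and>
          \<kappa> = \<bar>f \<Delta> - f (\<Delta> + 1)\<bar> \<and>
          real \<Delta> * \<kappa>\<^sup>2 / \<sigma>\<^sup>2 \<ge> 512 * ln (real \<Delta> / \<alpha>) \<longrightarrow>
          \<P>(\<omega> in M. enat \<Delta> < detection_time \<sigma> \<alpha> (\<lambda>i. X i \<omega>) \<and>
             ereal_of_enat (detection_time \<sigma> \<alpha> (\<lambda>i. X i \<omega>))
               \<le> ereal (real \<Delta> + 256 * (\<sigma>\<^sup>2 * ln (real \<Delta> / \<alpha>) / \<kappa>\<^sup>2))) \<ge> 1 - \<alpha>)"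
    (is "\<forall>M X f \<sigma> \<alpha>. ?hyps M X f \<sigma> \<alpha> \<longrightarrow> ?no_change M X f \<sigma> \<alpha> \<and> ?early M X f \<sigma> \<alpha> \<and> ?delay M X f \<sigma> \<alpha>")
  proof (intro allI impI)
    fix M :: "outcome measure" and X :: "nat \<Rightarrow> outcome \<Rightarrow> real" and f :: "nat \<Rightarrow> real" and \<sigma> \<alpha> :: real
    assume hyps: "?hyps M X f \<sigma> \<alpha>"
    then interpret prob_space M by blast
    have indep: "indep_vars (\<lambda>_. borel) X {1..}" and alpha: "0 < \<alpha>" "\<alpha> < 1" using hyps by blast+
    have mean: "expectation (X i) = f i" if "i \<ge> 1" for i using hyps that by blast
    have rv: "random_variable borel (X i)" if "i \<ge> 1" for i
      using indep that unfolding indep_vars_def by auto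
    have norm: "psi2_norm M (X i) \<le> ereal \<sigma>" if "i \<ge> 1" for i
      using hyps that by (meson SUP_upper atLeast_iff order_trans)
    have "0 \<le> ereal \<sigma>" using psi2_norm_nonneg norm[of 1] by (rule order_trans) simp
    \<comment> \<open>The scale 0 is treated apart, because the normalised variables
      \<open>X i / \<sigma>\<close> carry information only for positive \<sigma>.\<close>
    then consider "\<sigma> = 0" | "\<sigma> > 0" by fastforce
    then show "?no_change M X f \<sigma> \<alpha> \<and> ?early M X f \<sigma> \<alpha> \<and> ?delay M X f \<sigma> \<alpha>"
    proof cases
      case 1
      have zero: "AE \<omega> in M. X i \<omega> = 0" if "i \<ge> 1" for i
        using psi2_norm_zero_AE[OF rv[OF that]] norm[OF that] 1 by (simp add: zero_ereal_def)
      \<comment> \<open>All means vanish, so no change point can exist and the two claims about a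
        change hold vacuously.\<close>
      have "f i = 0" if "i \<ge> 1" for i
        using integral_eq_zero_AE[OF zero[OF that]] mean[OF that] by simp
      then show ?thesis using detection_time_infinite_of_zero[of X \<alpha>] zero alpha 1 by simp
    next
      case 2
      interpret psi2_bounded_sequence M X \<sigma> \<alpha>
        by unfold_locales (use indep alpha 2 in \<open>auto intro!: psi2_norm_leD rv norm\<close>)
      show ?thesis
      proof (intro conjI impI allI)
        assume const: "\<forall>i\<ge>1. f i = f 1"
        show "\<P>(\<omega> in M. detection_time \<sigma> \<alpha> (\<lambda>i. X i \<omega>) < \<infinity>) < \<alpha>"
          by (rule false_alarm_no_change) (rule trans[OF mean const[rule_format]])
      next
        fix \<Delta> :: nat
        assume \<Delta>: "1 \<le> \<Delta>" and f: "(\<forall>i\<in>{1..\<Delta>}. f i = f \<Delta>) \<and> f \<Delta> \<noteq> f (\<Delta> + 1) \<and> (\<forall>i\<ge>\<Delta> + 1. f i = f (\<Delta> + 1))"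
        have "\<P>(\<omega> in M. detection_time \<sigma> \<alpha> (\<lambda>i. X i \<omega>) \<le> enat \<Delta>) \<le> \<alpha> ^ 3 * (1 - 1 / real \<Delta>)"
        proof (rule false_alarm_before_change[OF \<Delta>])
          show "mean l = f \<Delta>" if "1 \<le> l" "l \<le> \<Delta>" for l
            using mean[OF that(1)] that f by (metis atLeastAtMost_iff)
        qed
        also have "\<dots> \<le> \<alpha> ^ 3 * 1" using alpha by (intro mult_left_mono) auto
        finally show "\<P>(\<omega> in M. detection_time \<sigma> \<alpha> (\<lambda>i. X i \<omega>) \<le> enat \<Delta>) < \<alpha>"
          using alpha_cube_less by simp
      next
        fix \<Delta> :: nat and \<kappa> :: real
        assume \<Delta>: "2 \<le> \<Delta>" and f: "(\<forall>i\<in>{1..\<Delta>}. f i = f \<Delta>) \<and> f \<Delta> \<noteq> f (\<Delta> + 1) \<and> (\<forall>i\<ge>\<Delta> + 1. f i = f (\<Delta> + 1)) \<and>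
          \<kappa> = \<bar>f \<Delta> - f (\<Delta> + 1)\<bar> \<and> real \<Delta> * \<kappa>\<^sup>2 / \<sigma>\<^sup>2 \<ge> 512 * ln (real \<Delta> / \<alpha>)"
        then have "\<kappa> = \<bar>f \<Delta> - f (\<Delta> + 1)\<bar>" by blast
        then have \<kappa>: "\<kappa>\<^sup>2 = (f \<Delta> - f (\<Delta> + 1))\<^sup>2" by simp
        show "\<P>(\<omega> in M. enat \<Delta> < detection_time \<sigma> \<alpha> (\<lambda>i. X i \<omega>) \<and>
             ereal_of_enat (detection_time \<sigma> \<alpha> (\<lambda>i. X i \<omega>))
               \<le> ereal (real \<Delta> + 256 * (\<sigma>\<^sup>2 * ln (real \<Delta> / \<alpha>) / \<kappa>\<^sup>2))) \<ge> 1 - \<alpha>"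
          unfolding \<kappa>
        proof (rule detection_delay[OF \<Delta>])
          show "mean l = f \<Delta>" if "1 \<le> l" "l \<le> \<Delta>" for l
            using mean[OF that(1)] that f by (metis atLeastAtMost_iff)
          show "mean l = f (\<Delta> + 1)" if "l > \<Delta>" for l
          proof -
            have "1 \<le> l" "\<Delta> + 1 \<le> l" using that by simp_all
            then show ?thesis using mean f by metis
          qed
          show "f \<Delta> \<noteq> f (\<Delta> + 1)" using f by blast
          show "512 * ln (real \<Delta> / \<alpha>) \<le> real \<Delta> * (f \<Delta> - f (\<Delta> + 1))\<^sup>2 / \<sigma>\<^sup>2"
            using f unfolding \<kappa> by blast
        qed
      qed
    qed
  qed
qed simp_all

end
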